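(* Let $\mathcal X$ be a compact subset of a metric space, let $\nu$ be a probability measure on the Borel field of $\mathcal X$ with positive density, and assume that the covariance kernel $K(x,u)$ defines an integral operator $$T_K(h)(\cdot)=\int_{\mathcal X}K(\cdot,u)h(u)\,\nu(du)$$ on $L_2(\nu)$ with eigenfunctions $\varphi_1,\varphi_2,\dots$ and positive eigenvalues $\lambda_1,\lambda_2,\dots$, i.e. $T_K(\varphi_\ell)=\lambda_\ell\varphi_\ell$, $\ell=1,2,\dots$. Consider the regression model $y(x)=\theta^Tf(x)+\varepsilon(x)$ with $f(x)=L(\varphi_{i_1}(x),\dots,\varphi_{i_m}(x))^T$ and covariance kernel $K(x,u)$, where $L\in\mathbb R^{m\times m}$ is a nonsingular matrix. Then the design $\nu$ is universally optimal.
   Context: The kernel $K$ is symmetric, continuous (except possibly at diagonal points) and positive definite: $\iint K(u,v)\,\mu(du)\,\mu(dv)\ge0$ for every signed measure $\mu$ on $\mathcal X$ (for which the integral is defined); it is the covariance kernel of the mean-zero error process $\varepsilon$, $K(x,x')=\mathrm E\,\varepsilon(x)\varepsilon(x')$, and is such that $T_K$ is a symmetric compact self-adjoint operator. The regression functions (components of $f$) are continuous and linearly independent; the indices $i_1,\dots,i_m$ are distinct, and the eigenvalue equations hold pointwise, for all $x\in\mathcal X$. A design is a (Borel) probability measure $\xi$ on $\mathcal X$. Set $$M(\xi)=\int f(u)f^T(u)\,\xi(du),\quad B(\xi,\xi)=\iint K(u,v)f(u)f^T(v)\,\xi(du)\,\xi(dv),$$ $$D(\xi)=M^{-1}(\xi)B(\xi,\xi)M^{-1}(\xi),$$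 and let $\Xi$ be the set of designs for which $B(\xi,\xi)$ and $M^{-1}(\xi)$ are well defined. A design $\xi^*\in\Xi$ is universally optimal if $D(\xi^* )\le D(\xi)$ in the Loewner ordering for every $\xi\in\Xi$. "$\nu$ has positive density" means in particular that $\nu$ has full support in $\mathcal X$.
   Formalization: "K defines an integral operator on L_2(ν)" is taken to include absolute convergence of the double integrals of K(x,u)g(x)h(u) against ν⊗ν for all g,h in L_2(ν); without such a condition B(ν,ν) can be undefined, so that ν is not in Ξ. *)

theory Defs
  imports "HOL-Probability.Probability"
begin

text \<open>
  A kernel takes values in the extended reals, since it may be singular (equal to \<open>\<infinity>\<close>) on the
  diagonal. Integrals of extended real functions are absolutely convergent Lebesgue integrals:
  the integrand is finite almost everywhere and its real part is Bochner integrable. The library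
  convention \<open>\<infinity> * 0 = 0\<close> for ereal is the one of measure theory.
\<close>

definition ereal_integrable :: "'b measure \<Rightarrow> ('b \<Rightarrow> ereal) \<Rightarrow> bool" where
  "ereal_integrable M F \<longleftrightarrow>
     (AE x in M. \<bar>F x\<bar> \<noteq> \<infinity>) \<and> integrable M (\<lambda>x. real_of_ereal (F x))"

definition ereal_integral :: "'b measure \<Rightarrow> ('b \<Rightarrow> ereal) \<Rightarrow> real" where
  "ereal_integral M F = (\<integral>x. real_of_ereal (F x) \<partial>M)"

definition finite_borel_measure_on :: "'a::metric_space set \<Rightarrow> 'a measure \<Rightarrow> bool" where
  "finite_borel_measure_on X \<mu> \<longleftrightarrow> finite_measure \<mu> \<and> sets \<mu> = sets (restrict_space borel X)"

definition design :: "'a::metric_space set \<Rightarrow> 'a measure \<Rightarrow> bool" where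
  "design X \<xi> \<longleftrightarrow> prob_space \<xi> \<and> sets \<xi> = sets (restrict_space borel X)"

definition full_support :: "'a::metric_space set \<Rightarrow> 'a measure \<Rightarrow> bool" where
  "full_support X \<nu> \<longleftrightarrow> (\<forall>U. open U \<and> U \<inter> X \<noteq> {} \<longrightarrow> measure \<nu> (U \<inter> X) > 0)"

definition kernel_integral ::
    "('a \<Rightarrow> 'a \<Rightarrow> ereal) \<Rightarrow> 'a measure \<Rightarrow> 'a measure \<Rightarrow> real" where
  "kernel_integral K \<mu> \<mu>' = ereal_integral (\<mu> \<Otimes>\<^sub>M \<mu>') (\<lambda>(u, v). K u v)"

definition kernel_integrable ::
    "('a \<Rightarrow> 'a \<Rightarrow> ereal) \<Rightarrow> 'a measure \<Rightarrow> 'a measure \<Rightarrow> bool" where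
  "kernel_integrable K \<mu> \<mu>' \<longleftrightarrow> ereal_integrable (\<mu> \<Otimes>\<^sub>M \<mu>') (\<lambda>(u, v). K u v)"

text \<open>
  A signed Borel measure is a difference \<open>p - n\<close> of two finite measures. The double integral of
  \<open>K\<close> against \<open>(p - n) \<otimes> (p - n)\<close> is written out, and is defined when the four integrals are.
  The pair need not be the Jordan decomposition; this does not change the condition, since the
  common part of \<open>p\<close> and \<open>n\<close> cancels.
\<close>

definition positive_definite_kernel :: "'a::metric_space set \<Rightarrow> ('a \<Rightarrow> 'a \<Rightarrow> ereal) \<Rightarrow> bool" where
  "positive_definite_kernel X K \<longleftrightarrow>
     (\<forall>p n. finite_borel_measure_on X p \<and> finite_borel_measure_on X n \<and>
        kernel_integrable K p p \<and> kernel_integrable K p n \<and>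
        kernel_integrable K n p \<and> kernel_integrable K n n \<longrightarrow>
        0 \<le> kernel_integral K p p - kernel_integral K p n
            - kernel_integral K n p + kernel_integral K n n)"

definition admissible_kernel :: "'a::metric_space set \<Rightarrow> ('a \<Rightarrow> 'a \<Rightarrow> ereal) \<Rightarrow> bool" where
  "admissible_kernel X K \<longleftrightarrow>
     (\<forall>u\<in>X. \<forall>v\<in>X. K u v = K v u) \<and>
     (\<forall>u\<in>X. \<forall>v\<in>X. u \<noteq> v \<longrightarrow> \<bar>K u v\<bar> \<noteq> \<infinity>) \<and>
     continuous_on {(u, v). u \<in> X \<and> v \<in> X \<and> u \<noteq> v} (\<lambda>(u, v). K u v) \<and>
     positive_definite_kernel X K"

text \<open>
  \<open>K u v\<close> is the expectation of \<open>\<epsilon> u * \<epsilon> v\<close>. On the diagonal the integrand is nonnegative and the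
  expectation is taken in \<open>[0, \<infinity>]\<close>; it is infinite exactly at the singular points of \<open>K\<close>.
\<close>

definition error_process ::
    "'w measure \<Rightarrow> 'a set \<Rightarrow> ('a \<Rightarrow> 'w \<Rightarrow> real) \<Rightarrow> ('a \<Rightarrow> 'a \<Rightarrow> ereal) \<Rightarrow> bool" where
  "error_process P X \<epsilon> K \<longleftrightarrow>
     prob_space P \<and>
     (\<forall>x\<in>X. integrable P (\<epsilon> x) \<and> (\<integral>\<omega>. \<epsilon> x \<omega> \<partial>P) = 0) \<and>
     (\<forall>u\<in>X. \<forall>v\<in>X. u \<noteq> v \<longrightarrow> integrable P (\<lambda>\<omega>. \<epsilon> u \<omega> * \<epsilon> v \<omega>) \<and>
        K u v = ereal (\<integral>\<omega>. \<epsilon> u \<omega> * \<epsilon> v \<omega> \<partial>P)) \<and>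
     (\<forall>x\<in>X. K x x = enn2ereal (\<integral>\<^sup>+\<omega>. ennreal (\<epsilon> x \<omega> * \<epsilon> x \<omega>) \<partial>P))"

definition regression_model ::
    "'w measure \<Rightarrow> 'a::metric_space set \<Rightarrow> ('a \<Rightarrow> real ^ 'm::finite) \<Rightarrow> ('a \<Rightarrow> 'a \<Rightarrow> ereal) \<Rightarrow>
     real ^ 'm \<Rightarrow> ('a \<Rightarrow> 'w \<Rightarrow> real) \<Rightarrow> ('a \<Rightarrow> 'w \<Rightarrow> real) \<Rightarrow> bool" where
  "regression_model P X f K \<theta> \<epsilon> y \<longleftrightarrow>
     error_process P X \<epsilon> K \<and>
     (\<forall>x\<in>X. \<forall>\<omega>\<in>space P. y x \<omega> = \<theta> \<bullet> f x + \<epsilon> x \<omega>) \<and>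
     continuous_on X f \<and>
     (\<forall>a. (\<forall>x\<in>X. a \<bullet> f x = 0) \<longrightarrow> a = 0)"

definition square_integrable :: "'a measure \<Rightarrow> ('a \<Rightarrow> real) \<Rightarrow> bool" where
  "square_integrable \<nu> h \<longleftrightarrow> h \<in> borel_measurable \<nu> \<and> integrable \<nu> (\<lambda>x. (h x)\<^sup>2)"

definition integral_op ::
    "'a measure \<Rightarrow> ('a \<Rightarrow> 'a \<Rightarrow> ereal) \<Rightarrow> ('a \<Rightarrow> real) \<Rightarrow> 'a \<Rightarrow> real" where
  "integral_op \<nu> K h x = ereal_integral \<nu> (\<lambda>u. K x u * ereal (h u))"

text \<open>
  The first clause says that the integrals defining \<open>\<langle>g, T\<^sub>K h\<rangle>\<close> converge absolutely for all
  \<open>g\<close>, \<open>h\<close> in \<open>L\<^sub>2(\<nu>)\<close>. In particular \<open>T\<^sub>K h\<close> exists almost everywhere.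
\<close>

definition defines_integral_operator :: "'a measure \<Rightarrow> ('a \<Rightarrow> 'a \<Rightarrow> ereal) \<Rightarrow> bool" where
  "defines_integral_operator \<nu> K \<longleftrightarrow>
     (\<forall>g h. square_integrable \<nu> g \<and> square_integrable \<nu> h \<longrightarrow>
        ereal_integrable (\<nu> \<Otimes>\<^sub>M \<nu>) (\<lambda>(x, u). K x u * ereal (g x) * ereal (h u))) \<and>
     (\<forall>h. square_integrable \<nu> h \<longrightarrow> square_integrable \<nu> (integral_op \<nu> K h))"

definition self_adjoint_L2 :: "'a measure \<Rightarrow> (('a \<Rightarrow> real) \<Rightarrow> 'a \<Rightarrow> real) \<Rightarrow> bool" where
  "self_adjoint_L2 \<nu> T \<longleftrightarrow>
     (\<forall>g h. square_integrable \<nu> g \<and> square_integrable \<nu> h \<longrightarrow>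
        (\<integral>x. T g x * h x \<partial>\<nu>) = (\<integral>x. g x * T h x \<partial>\<nu>))"

definition compact_operator_L2 :: "'a measure \<Rightarrow> (('a \<Rightarrow> real) \<Rightarrow> 'a \<Rightarrow> real) \<Rightarrow> bool" where
  "compact_operator_L2 \<nu> T \<longleftrightarrow>
     (\<forall>h :: nat \<Rightarrow> 'a \<Rightarrow> real.
        (\<forall>n. square_integrable \<nu> (h n) \<and> (\<integral>x. (h n x)\<^sup>2 \<partial>\<nu>) \<le> 1) \<longrightarrow>
        (\<exists>(r :: nat \<Rightarrow> nat) g. strict_mono r \<and> square_integrable \<nu> g \<and>
           (\<lambda>n. \<integral>x. (T (h (r n)) x - g x)\<^sup>2 \<partial>\<nu>) \<longlonglongrightarrow> 0))"

text \<open>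
  The eigenvalue equation is required at every point of \<open>X\<close>, not only almost everywhere.
\<close>

definition eigenpair ::
    "'a set \<Rightarrow> 'a measure \<Rightarrow> ('a \<Rightarrow> 'a \<Rightarrow> ereal) \<Rightarrow> real \<Rightarrow> ('a \<Rightarrow> real) \<Rightarrow> bool" where
  "eigenpair X \<nu> K c \<phi> \<longleftrightarrow>
     square_integrable \<nu> \<phi> \<and> \<not> (AE x in \<nu>. \<phi> x = 0) \<and>
     (\<forall>x\<in>X. ereal_integrable \<nu> (\<lambda>u. K x u * ereal (\<phi> u)) \<and>
        integral_op \<nu> K \<phi> x = c * \<phi> x)"

definition M_mat :: "('a \<Rightarrow> real ^ 'm::finite) \<Rightarrow> 'a measure \<Rightarrow> real ^ 'm ^ 'm" where
  "M_mat f \<xi> = (\<chi> i j. \<integral>u. f u $ i * f u $ j \<partial>\<xi>)"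

definition B_mat ::
    "('a \<Rightarrow> 'a \<Rightarrow> ereal) \<Rightarrow> ('a \<Rightarrow> real ^ 'm::finite) \<Rightarrow> 'a measure \<Rightarrow> real ^ 'm ^ 'm" where
  "B_mat K f \<xi> = (\<chi> i j. ereal_integral (\<xi> \<Otimes>\<^sub>M \<xi>)
     (\<lambda>(u, v). K u v * ereal (f u $ i) * ereal (f v $ j)))"

definition D_mat ::
    "('a \<Rightarrow> 'a \<Rightarrow> ereal) \<Rightarrow> ('a \<Rightarrow> real ^ 'm::finite) \<Rightarrow> 'a measure \<Rightarrow> real ^ 'm ^ 'm" where
  "D_mat K f \<xi> = matrix_inv (M_mat f \<xi>) ** B_mat K f \<xi> ** matrix_inv (M_mat f \<xi>)"

definition admissible_designs ::
    "'a::metric_space set \<Rightarrow> ('a \<Rightarrow> 'a \<Rightarrow> ereal) \<Rightarrow> ('a \<Rightarrow> real ^ 'm::finite) \<Rightarrow> 'a measure set" where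
  "admissible_designs X K f = {\<xi>. design X \<xi> \<and>
     (\<forall>i j. integrable \<xi> (\<lambda>u. f u $ i * f u $ j)) \<and>
     invertible (M_mat f \<xi>) \<and>
     (\<forall>i j. ereal_integrable (\<xi> \<Otimes>\<^sub>M \<xi>) (\<lambda>(u, v). K u v * ereal (f u $ i) * ereal (f v $ j)))}"

definition loewner_le :: "real ^ 'm ^ 'm::finite \<Rightarrow> real ^ 'm ^ 'm \<Rightarrow> bool" where
  "loewner_le A B \<longleftrightarrow> transpose (B - A) = B - A \<and> (\<forall>z. 0 \<le> z \<bullet> ((B - A) *v z))"

definition universally_optimal ::
    "'a::metric_space set \<Rightarrow> ('a \<Rightarrow> 'a \<Rightarrow> ereal) \<Rightarrow> ('a \<Rightarrow> real ^ 'm::finite) \<Rightarrow> 'a measure \<Rightarrow> bool" where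
  "universally_optimal X K f \<xi>\<^sub>0 \<longleftrightarrow>
     \<xi>\<^sub>0 \<in> admissible_designs X K f \<and>
     (\<forall>\<xi>\<in>admissible_designs X K f. loewner_le (D_mat K f \<xi>\<^sub>0) (D_mat K f \<xi>))"

end

theory Submission
  imports Defs
begin

text \<open>
  Fix a vector \<open>z\<close> and put \<open>a = M(\<xi>)\<^sup>-\<^sup>1 z\<close>. Then \<open>z\<^sup>T D(\<xi>) z\<close> is the energy of the signed measure
  \<open>\<mu>\<^sub>\<xi> = (a\<^sup>T f) d\<xi>\<close>, and \<open>\<integral> f d\<mu>\<^sub>\<xi> = z\<close> for every design. As \<open>f\<close> spans an invariant subspace of
  \<open>T\<^sub>K\<close>, the potential \<open>\<integral> K(u,v) \<mu>\<^sub>\<nu>(dv)\<close> equals \<open>d\<^sup>T f(u)\<close> for some vector \<open>d\<close>, so the mutual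
  energy of \<open>\<mu>\<^sub>\<xi>\<close> and \<open>\<mu>\<^sub>\<nu>\<close> is \<open>d\<^sup>T z\<close>, independently of \<open>\<xi>\<close>, and equals the energy of \<open>\<mu>\<^sub>\<nu>\<close>.
  Positive definiteness applied to \<open>\<mu>\<^sub>\<xi> - \<mu>\<^sub>\<nu>\<close> gives the claim.
\<close>

section \<open>Real densities with respect to a common dominating measure\<close>

lemma finite_measure_real_density:
  assumes "finite_measure \<beta>" "finite_measure \<xi>" "sets \<xi> = sets \<beta>" "absolutely_continuous \<beta> \<xi>"
  obtains g :: "'a \<Rightarrow> real" where "g \<in> borel_measurable \<beta>" "\<And>x. 0 \<le> g x" "\<xi> = density \<beta> g"
proof -
  interpret B: finite_measure \<beta> by fact
  interpret F: finite_measure \<xi> by fact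
  obtain D :: "'a \<Rightarrow> real" where D: "D \<in> borel_measurable \<beta>"
      "AE x in \<beta>. RN_deriv \<beta> \<xi> x = ennreal (D x)" "\<And>x. 0 \<le> D x"
    using B.real_RN_deriv[OF assms(2,4,3)] by metis
  have "\<xi> = density \<beta> (RN_deriv \<beta> \<xi>)"
    using B.density_RN_deriv[OF assms(4,3)] by simp
  also have "\<dots> = density \<beta> D"
    by (rule density_cong) (use D in auto)
  finally show thesis using that[OF D(1,3)] by simp
qed

text \<open>The sum of the two measures is finite and dominates both, so Radon-Nikodym applies
  twice. The common base serves to subtract signed measures carried by \<xi> and by \<nu>, which may
  be mutually singular: over \<beta> their difference has a single real density.\<close>

lemma finite_measures_common_density:
  assumes "finite_measure \<xi>" "finite_measure \<nu>" "sets \<nu> = sets \<xi>"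
  obtains \<beta> :: "'a measure" and g h :: "'a \<Rightarrow> real"
  where "finite_measure \<beta>" "sets \<beta> = sets \<xi>"
    "g \<in> borel_measurable \<beta>" "\<And>x. 0 \<le> g x" "\<xi> = density \<beta> g"
    "h \<in> borel_measurable \<beta>" "\<And>x. 0 \<le> h x" "\<nu> = density \<beta> h"
proof -
  interpret F: finite_measure \<xi> by fact
  interpret N: finite_measure \<nu> by fact
  define \<beta> where "\<beta> = measure_of (space \<xi>) (sets \<xi>) (\<lambda>A. emeasure \<xi> A + emeasure \<nu> A)"
  have sets: "sets \<beta> = sets \<xi>" by (simp add: \<beta>_def)
  have em: "emeasure \<beta> A = emeasure \<xi> A + emeasure \<nu> A" if "A \<in> sets \<xi>" for A
  proof (rule emeasure_measure_of[OF \<beta>_def])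
    show "sets \<xi> \<subseteq> Pow (space \<xi>)" by (rule sets.space_closed)
    show "A \<in> sets \<beta>" using that by (simp add: sets)
    show "positive (sets \<beta>) (\<lambda>A. emeasure \<xi> A + emeasure \<nu> A)"
      by (simp add: positive_def)
    show "countably_additive (sets \<beta>) (\<lambda>A. emeasure \<xi> A + emeasure \<nu> A)"
    proof (rule countably_additiveI)
      fix A :: "nat \<Rightarrow> 'a set"
      assume A: "range A \<subseteq> sets \<beta>" "disjoint_family A"
      have "(\<Sum>i. emeasure \<xi> (A i) + emeasure \<nu> (A i)) =
          (\<Sum>i. emeasure \<xi> (A i)) + (\<Sum>i. emeasure \<nu> (A i))"
        by (rule suminf_add[symmetric]) auto
      also have "\<dots> = emeasure \<xi> (\<Union>i. A i) + emeasure \<nu> (\<Union>i. A i)"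
        using A by (simp add: suminf_emeasure sets assms(3))
      finally show "(\<Sum>i. emeasure \<xi> (A i) + emeasure \<nu> (A i)) =
          emeasure \<xi> (\<Union>i. A i) + emeasure \<nu> (\<Union>i. A i)" .
    qed
  qed
  have fin: "finite_measure \<beta>"
  proof
    have "space \<beta> = space \<xi>" by (simp add: \<beta>_def)
    then show "emeasure \<beta> (space \<beta>) \<noteq> \<infinity>"
      using em[of "space \<xi>"] N.emeasure_finite[of "space \<xi>"] by (simp add: ennreal_add_eq_top)
  qed
  have "absolutely_continuous \<beta> \<xi>" "absolutely_continuous \<beta> \<nu>"
    unfolding absolutely_continuous_def null_sets_def using em assms(3) sets by auto
  then obtain g h :: "'a \<Rightarrow> real" where "g \<in> borel_measurable \<beta>" "\<And>x. 0 \<le> g x" "\<xi> = density \<beta> g"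
    "h \<in> borel_measurable \<beta>" "\<And>x. 0 \<le> h x" "\<nu> = density \<beta> h"
    using finite_measure_real_density[OF fin assms(1)] finite_measure_real_density[OF fin assms(2)]
      sets assms(3) by metis
  then show thesis using that[OF fin sets] by blast
qed

lemma pair_measure_real_density:
  fixes g h :: "'a \<Rightarrow> real"
  assumes "finite_measure \<beta>" "finite_measure (density \<beta> h)"
    and [measurable]: "g \<in> borel_measurable \<beta>" "h \<in> borel_measurable \<beta>"
    and "\<And>x. 0 \<le> g x" "\<And>x. 0 \<le> h x"
  shows "density \<beta> g \<Otimes>\<^sub>M density \<beta> h = density (\<beta> \<Otimes>\<^sub>M \<beta>) (\<lambda>(x, y). ennreal (g x * h y))"
proof -
  interpret B: finite_measure \<beta> by fact
  interpret H: finite_measure "density \<beta> h" by fact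
  have "density \<beta> g \<Otimes>\<^sub>M density \<beta> h = density (\<beta> \<Otimes>\<^sub>M \<beta>) (\<lambda>(x, y). ennreal (g x) * ennreal (h y))"
    by (rule pair_measure_density) (unfold_locales, auto)
  then show ?thesis using assms(5,6) by (simp add: ennreal_mult)
qed

text \<open>This reduces energies to integrals over the one space
  \<open>\<beta> \<Otimes>\<^sub>M \<beta>\<close>. The product measure has density
  \<open>g x * h y\<close>, which by nonnegativity is positive exactly where both factors are; hence
  the guard in the almost everywhere clause.\<close>

lemma integral_pair_density:
  fixes g h :: "'a \<Rightarrow> real" and F :: "'a \<times> 'a \<Rightarrow> real"
  assumes "finite_measure \<beta>" "finite_measure (density \<beta> h)"
    and [measurable]: "g \<in> borel_measurable \<beta>" "h \<in> borel_measurable \<beta>"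
      "F \<in> borel_measurable (\<beta> \<Otimes>\<^sub>M \<beta>)"
    and nn: "\<And>x. 0 \<le> g x" "\<And>x. 0 \<le> h x"
  shows "(\<integral>p. F p \<partial>(density \<beta> g \<Otimes>\<^sub>M density \<beta> h)) = (\<integral>(x, y). F (x, y) * g x * h y \<partial>(\<beta> \<Otimes>\<^sub>M \<beta>))"
    and "integrable (density \<beta> g \<Otimes>\<^sub>M density \<beta> h) F \<longleftrightarrow>
      integrable (\<beta> \<Otimes>\<^sub>M \<beta>) (\<lambda>(x, y). F (x, y) * g x * h y)"
    and "(AE p in density \<beta> g \<Otimes>\<^sub>M density \<beta> h. Q p) \<longleftrightarrow>
      (AE (x, y) in \<beta> \<Otimes>\<^sub>M \<beta>. 0 < g x \<and> 0 < h y \<longrightarrow> Q (x, y))"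
proof -
  have eq: "density \<beta> g \<Otimes>\<^sub>M density \<beta> h = density (\<beta> \<Otimes>\<^sub>M \<beta>) (\<lambda>p. ennreal (g (fst p) * h (snd p)))"
    using pair_measure_real_density[OF assms(1,2,3,4) nn] by (simp add: split_beta')
  show "(\<integral>p. F p \<partial>(density \<beta> g \<Otimes>\<^sub>M density \<beta> h)) = (\<integral>(x, y). F (x, y) * g x * h y \<partial>(\<beta> \<Otimes>\<^sub>M \<beta>))"
    unfolding eq by (subst integral_density) (auto simp: nn split_beta' mult_ac)
  show "integrable (density \<beta> g \<Otimes>\<^sub>M density \<beta> h) F \<longleftrightarrow>
      integrable (\<beta> \<Otimes>\<^sub>M \<beta>) (\<lambda>(x, y). F (x, y) * g x * h y)"
    unfolding eq by (subst integrable_density) (auto simp: nn split_beta' mult_ac)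
  have "0 < g x * h y \<longleftrightarrow> 0 < g x \<and> 0 < h y" for x y
    using nn(1)[of x] nn(2)[of y] by (auto simp: zero_less_mult_iff)
  then show "(AE p in density \<beta> g \<Otimes>\<^sub>M density \<beta> h. Q p) \<longleftrightarrow>
      (AE (x, y) in \<beta> \<Otimes>\<^sub>M \<beta>. 0 < g x \<and> 0 < h y \<longrightarrow> Q (x, y))"
    unfolding eq by (subst AE_density) (auto simp: split_beta')
qed

section \<open>Positive definiteness for signed densities\<close>

lemma finite_measure_integrable_density:
  fixes g :: "'a \<Rightarrow> real"
  assumes "integrable \<beta> g" "\<And>x. 0 \<le> g x"
  shows "finite_measure (density \<beta> g)"
proof
  have "emeasure (density \<beta> g) (space (density \<beta> g)) = (\<integral>\<^sup>+x. ennreal (g x) \<partial>\<beta>)"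
    using assms(1) by (subst emeasure_density) (auto intro!: nn_integral_cong)
  also have "\<dots> = ennreal (\<integral>x. g x \<partial>\<beta>)"
    using assms by (intro nn_integral_eq_integral) auto
  finally show "emeasure (density \<beta> g) (space (density \<beta> g)) \<noteq> \<infinity>" by simp
qed

text \<open>Positive definiteness is stated for pairs of positive measures. Applied to the densities
  given by the positive and negative parts of \<open>w\<close>, its four terms recombine by
  bilinearity into one integral against \<open>w u * w v\<close>.\<close>

lemma positive_definite_kernel_signed_density:
  fixes w :: "'a::metric_space \<Rightarrow> real"
  assumes pd: "positive_definite_kernel X K"
    and \<beta>: "finite_borel_measure_on X \<beta>"
    and w: "integrable \<beta> w"
    and k[measurable]: "(\<lambda>(u, v). real_of_ereal (K u v)) \<in> borel_measurable (\<beta> \<Otimes>\<^sub>M \<beta>)"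
    and int: "integrable (\<beta> \<Otimes>\<^sub>M \<beta>) (\<lambda>(u, v). real_of_ereal (K u v) * w u * w v)"
    and ae: "AE (u, v) in \<beta> \<Otimes>\<^sub>M \<beta>. w u \<noteq> 0 \<and> w v \<noteq> 0 \<longrightarrow> \<bar>K u v\<bar> \<noteq> \<infinity>"
  shows "0 \<le> (\<integral>(u, v). real_of_ereal (K u v) * w u * w v \<partial>(\<beta> \<Otimes>\<^sub>M \<beta>))"
proof -
  define p n where "p x = max 0 (w x)" and "n x = max 0 (- w x)" for x
  have [measurable]: "w \<in> borel_measurable \<beta>" using w by simp
  have [measurable]: "p \<in> borel_measurable \<beta>" "n \<in> borel_measurable \<beta>"
    by (simp_all add: p_def[abs_def] n_def[abs_def])
  have ip: "integrable \<beta> p" and iN: "integrable \<beta> n"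
    using w by (simp_all add: p_def[abs_def] n_def[abs_def])
  have fin: "finite_measure \<beta>" using \<beta> by (simp add: finite_borel_measure_on_def)
  have part: "kernel_integrable K (density \<beta> g) (density \<beta> h) \<and>
      kernel_integral K (density \<beta> g) (density \<beta> h) =
        (\<integral>(u, v). real_of_ereal (K u v) * g u * h v \<partial>(\<beta> \<Otimes>\<^sub>M \<beta>)) \<and>
      integrable (\<beta> \<Otimes>\<^sub>M \<beta>) (\<lambda>(u, v). real_of_ereal (K u v) * g u * h v) \<and>
      finite_borel_measure_on X (density \<beta> g)"
    if "g \<in> {p, n}" "h \<in> {p, n}" for g h
  proof -
    have [measurable]: "g \<in> borel_measurable \<beta>" "h \<in> borel_measurable \<beta>" using that by auto
    have ig: "integrable \<beta> g" "integrable \<beta> h" using that ip iN by auto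
    have nn: "0 \<le> g x" "0 \<le> h x" for x using that by (auto simp: p_def n_def)
    have le: "g x \<le> \<bar>w x\<bar>" "h x \<le> \<bar>w x\<bar>" for x using that by (auto simp: p_def n_def)
    have fg: "finite_measure (density \<beta> g)" "finite_measure (density \<beta> h)"
      using finite_measure_integrable_density ig nn by auto
    note dens = integral_pair_density[OF fin fg(2) _ _ k nn]
    \<comment> \<open>Both parts of \<open>w\<close> are at most \<bar>w\<bar>, so each of the four
      integrands is dominated by the one assumed integrable in \<open>int\<close>.\<close>
    have I: "integrable (\<beta> \<Otimes>\<^sub>M \<beta>) (\<lambda>(u, v). real_of_ereal (K u v) * g u * h v)"
    proof (rule Bochner_Integration.integrable_bound[OF int])
      show "AE p in \<beta> \<Otimes>\<^sub>M \<beta>. norm (case p of (u, v) \<Rightarrow> real_of_ereal (K u v) * g u * h v)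
          \<le> norm (case p of (u, v) \<Rightarrow> real_of_ereal (K u v) * w u * w v)"
        using nn le by (intro AE_I2) (auto simp: abs_mult intro!: mult_mono mult_nonneg_nonneg real_of_ereal_pos)
      show "(\<lambda>(u, v). real_of_ereal (K u v) * g u * h v) \<in> borel_measurable (\<beta> \<Otimes>\<^sub>M \<beta>)"
        using k by (simp add: split_beta')
    qed
    \<comment> \<open>Points charged by either density lie where \<open>w\<close> is nonzero, so the
      guarded hypothesis \<open>ae\<close> yields finiteness of \<open>K\<close> almost everywhere
      for the product of the two densities.\<close>
    have pos: "w x \<noteq> 0" if "0 < g x \<or> 0 < h x" for x
      using le[of x] that by auto
    have "kernel_integrable K (density \<beta> g) (density \<beta> h)"
      unfolding kernel_integrable_def ereal_integrable_def
    proof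
      show "AE x in density \<beta> g \<Otimes>\<^sub>M density \<beta> h. \<bar>case x of (u, v) \<Rightarrow> K u v\<bar> \<noteq> \<infinity>"
        by (subst dens(3)) (use ae pos in \<open>auto elim!: eventually_mono\<close>)
      show "integrable (density \<beta> g \<Otimes>\<^sub>M density \<beta> h) (\<lambda>x. real_of_ereal (case x of (u, v) \<Rightarrow> K u v))"
        using dens(2) I by (simp add: split_beta')
    qed
    moreover have "kernel_integral K (density \<beta> g) (density \<beta> h) =
        (\<integral>(u, v). real_of_ereal (K u v) * g u * h v \<partial>(\<beta> \<Otimes>\<^sub>M \<beta>))"
      unfolding kernel_integral_def ereal_integral_def using dens(1) by (simp add: split_beta')
    ultimately show ?thesis
      using I fg(1) \<beta> by (simp add: finite_borel_measure_on_def)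
  qed
  let ?I = "\<lambda>g h. \<integral>(u, v). real_of_ereal (K u v) * g u * h v \<partial>(\<beta> \<Otimes>\<^sub>M \<beta>)"
  have "0 \<le> kernel_integral K (density \<beta> p) (density \<beta> p) - kernel_integral K (density \<beta> p) (density \<beta> n)
      - kernel_integral K (density \<beta> n) (density \<beta> p) + kernel_integral K (density \<beta> n) (density \<beta> n)"
    using pd part unfolding positive_definite_kernel_def by blast
  also have "\<dots> = ?I p p - ?I p n - ?I n p + ?I n n"
    using part by simp
  also have "\<dots> = (\<integral>(u, v). real_of_ereal (K u v) * p u * p v - real_of_ereal (K u v) * p u * n v
      - real_of_ereal (K u v) * n u * p v + real_of_ereal (K u v) * n u * n v \<partial>(\<beta> \<Otimes>\<^sub>M \<beta>))"
    using part unfolding split_beta' by simp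
  also have "\<dots> = ?I w w"
  proof (rule Bochner_Integration.integral_cong[OF refl])
    have w_eq: "w = (\<lambda>x. p x - n x)" by (auto simp: p_def n_def)
    show "(case x of (u, v) \<Rightarrow> real_of_ereal (K u v) * p u * p v - real_of_ereal (K u v) * p u * n v
      - real_of_ereal (K u v) * n u * p v + real_of_ereal (K u v) * n u * n v) =
      (case x of (u, v) \<Rightarrow> real_of_ereal (K u v) * w u * w v)" for x
      by (auto simp: w_eq algebra_simps split: prod.split)
  qed
  finally show ?thesis .
qed

section \<open>Mixed energies of signed measures with different base measures\<close>

text \<open>
  A function \<open>g\<close> integrated against \<open>\<mu>\<close> stands for the signed measure \<open>g d\<mu>\<close>. Since
  \<open>real_of_ereal\<close> sends \<open>\<infinity>\<close> to \<open>0\<close>, finiteness of \<open>K\<close> has to be required separately, and only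
  where the weights do not vanish.
\<close>

definition kernel_form ::
    "('a \<Rightarrow> 'a \<Rightarrow> ereal) \<Rightarrow> 'a measure \<Rightarrow> ('a \<Rightarrow> real) \<Rightarrow> 'a measure \<Rightarrow> ('a \<Rightarrow> real) \<Rightarrow> real" where
  "kernel_form K \<mu> g \<mu>' h = (\<integral>(u, v). real_of_ereal (K u v) * g u * h v \<partial>(\<mu> \<Otimes>\<^sub>M \<mu>'))"

definition kernel_form_defined ::
    "('a \<Rightarrow> 'a \<Rightarrow> ereal) \<Rightarrow> 'a measure \<Rightarrow> ('a \<Rightarrow> real) \<Rightarrow> 'a measure \<Rightarrow> ('a \<Rightarrow> real) \<Rightarrow> bool" where
  "kernel_form_defined K \<mu> g \<mu>' h \<longleftrightarrow>
     integrable (\<mu> \<Otimes>\<^sub>M \<mu>') (\<lambda>(u, v). real_of_ereal (K u v) * g u * h v) \<and>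
     (AE (u, v) in \<mu> \<Otimes>\<^sub>M \<mu>'. g u \<noteq> 0 \<and> h v \<noteq> 0 \<longrightarrow> \<bar>K u v\<bar> \<noteq> \<infinity>)"

text \<open>The signed measure g d\<xi> - h d\<nu> has nonnegative energy. Expanding it bilinearly
  gives two pure and two mixed terms, and symmetry of \<open>K\<close> makes the mixed terms
  equal.\<close>

lemma kernel_form_cross_le:
  fixes g h :: "'a::metric_space \<Rightarrow> real"
  assumes pd: "positive_definite_kernel X K"
    and sym: "\<And>u v. u \<in> X \<Longrightarrow> v \<in> X \<Longrightarrow> K u v = K v u"
    and \<xi>: "finite_borel_measure_on X \<xi>" and \<nu>: "finite_borel_measure_on X \<nu>"
    and k: "(\<lambda>(u, v). real_of_ereal (K u v)) \<in> borel_measurable (\<nu> \<Otimes>\<^sub>M \<nu>)"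
    and g: "integrable \<xi> g" and h: "integrable \<nu> h"
    and gg: "kernel_form_defined K \<xi> g \<xi> g"
    and gh: "kernel_form_defined K \<xi> g \<nu> h"
    and hh: "kernel_form_defined K \<nu> h \<nu> h"
  shows "2 * kernel_form K \<xi> g \<nu> h \<le> kernel_form K \<xi> g \<xi> g + kernel_form K \<nu> h \<nu> h"
proof -
  have fin: "finite_measure \<xi>" "finite_measure \<nu>" and s: "sets \<nu> = sets \<xi>"
    using \<xi> \<nu> by (auto simp: finite_borel_measure_on_def)
  obtain \<beta> and p q :: "'a \<Rightarrow> real" where \<beta>: "finite_measure \<beta>" "sets \<beta> = sets \<xi>"
    and p[measurable]: "p \<in> borel_measurable \<beta>" and p0: "\<And>x. 0 \<le> p x" and pe: "\<xi> = density \<beta> p"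
    and q[measurable]: "q \<in> borel_measurable \<beta>" and q0: "\<And>x. 0 \<le> q x" and qe: "\<nu> = density \<beta> q"
    by (rule finite_measures_common_density[OF fin s], rule that)
  have \<beta>X: "finite_borel_measure_on X \<beta>" using \<beta> \<xi> by (simp add: finite_borel_measure_on_def)
  have "sets \<beta> = sets (restrict_space borel X)"
    using \<beta>X by (simp add: finite_borel_measure_on_def)
  from sets_eq_imp_space_eq[OF this] have sp: "space \<beta> = X"
    by (simp add: space_restrict_space)
  interpret B: finite_measure \<beta> by fact
  interpret BB: pair_sigma_finite \<beta> \<beta> ..
  have k'[measurable]: "(\<lambda>(u, v). real_of_ereal (K u v)) \<in> borel_measurable (\<beta> \<Otimes>\<^sub>M \<beta>)"
    using k s \<beta>(2) by (simp cong: sets_pair_measure_cong measurable_cong_sets)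
  have gm[measurable]: "g \<in> borel_measurable \<beta>" and hm[measurable]: "h \<in> borel_measurable \<beta>"
    using g h pe qe by (simp_all cong: measurable_cong_sets)
  \<comment> \<open>Densities over \<beta> of the two signed measures g d\<xi> and h d\<nu>.\<close>
  define gw hw where "gw x = g x * p x" and "hw x = h x * q x" for x
  have [measurable]: "gw \<in> borel_measurable \<beta>" "hw \<in> borel_measurable \<beta>"
    by (simp_all add: gw_def[abs_def] hw_def[abs_def])
  have gwi: "integrable \<beta> gw" and hwi: "integrable \<beta> hw"
    using g h unfolding pe qe by (auto simp: integrable_density p0 q0 gw_def[abs_def] hw_def[abs_def] mult_ac)
  \<comment> \<open>The weights are absorbed into the densities. Where \<open>r\<close> or
    \<open>t\<close> vanishes, the measures \<open>density \<beta> r\<close> and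
    \<open>density \<beta> t\<close> give no information on \<open>K\<close>, but there the new
    weights vanish too, so nothing is required.\<close>
  have transfer: "kernel_form_defined K (density \<beta> r) a (density \<beta> t) b \<Longrightarrow>
        kernel_form_defined K \<beta> (\<lambda>x. a x * r x) \<beta> (\<lambda>x. b x * t x)"
      "kernel_form K (density \<beta> r) a (density \<beta> t) b =
        kernel_form K \<beta> (\<lambda>x. a x * r x) \<beta> (\<lambda>x. b x * t x)"
    if [measurable]: "a \<in> borel_measurable \<beta>" "b \<in> borel_measurable \<beta>"
        "r \<in> borel_measurable \<beta>" "t \<in> borel_measurable \<beta>"
      and nn: "\<And>x. 0 \<le> r x" "\<And>x. 0 \<le> t x" and f: "finite_measure (density \<beta> t)"
    for a b r t :: "'a \<Rightarrow> real"
  proof -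
    have m: "(\<lambda>(u, v). real_of_ereal (K u v) * a u * b v) \<in> borel_measurable (\<beta> \<Otimes>\<^sub>M \<beta>)"
      using k' by (simp add: split_beta')
    note dens = integral_pair_density[OF \<beta>(1) f _ _ m nn]
    show "kernel_form_defined K (density \<beta> r) a (density \<beta> t) b \<Longrightarrow>
        kernel_form_defined K \<beta> (\<lambda>x. a x * r x) \<beta> (\<lambda>x. b x * t x)"
      unfolding kernel_form_defined_def using dens(2)
      by (subst (asm) dens(3)) (use nn in \<open>auto simp: split_beta' mult_ac less_le elim!: eventually_mono\<close>)
    show "kernel_form K (density \<beta> r) a (density \<beta> t) b =
        kernel_form K \<beta> (\<lambda>x. a x * r x) \<beta> (\<lambda>x. b x * t x)"
      unfolding kernel_form_def using dens(1) by (simp add: split_beta' mult_ac)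
  qed
  have GG: "kernel_form_defined K \<beta> gw \<beta> gw" and GH: "kernel_form_defined K \<beta> gw \<beta> hw"
    and HH: "kernel_form_defined K \<beta> hw \<beta> hw"
    using transfer(1)[OF gm gm p p p0 p0] transfer(1)[OF gm hm p q p0 q0] transfer(1)[OF hm hm q q q0 q0]
      gg gh hh fin unfolding gw_def[abs_def] hw_def[abs_def] pe[symmetric] qe[symmetric] by auto
  have e: "kernel_form K \<xi> g \<xi> g = kernel_form K \<beta> gw \<beta> gw"
    "kernel_form K \<xi> g \<nu> h = kernel_form K \<beta> gw \<beta> hw"
    "kernel_form K \<nu> h \<nu> h = kernel_form K \<beta> hw \<beta> hw"
    using transfer(2)[OF gm gm p p p0 p0] transfer(2)[OF gm hm p q p0 q0] transfer(2)[OF hm hm q q q0 q0]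
      fin unfolding gw_def[abs_def] hw_def[abs_def] pe[symmetric] qe[symmetric] by auto
  \<comment> \<open>Only one order of the mixed term is assumed to be defined; the other comes from
    exchanging the variables and the symmetry of \<open>K\<close> on \<open>X\<close>.\<close>
  have swap_int: "integrable (\<beta> \<Otimes>\<^sub>M \<beta>) (\<lambda>(u, v). real_of_ereal (K u v) * hw u * gw v)"
    and swap_eq: "kernel_form K \<beta> hw \<beta> gw = kernel_form K \<beta> gw \<beta> hw"
  proof -
    let ?F = "\<lambda>(u, v). real_of_ereal (K u v) * gw u * hw v"
    have eq: "(case x of (u, v) \<Rightarrow> real_of_ereal (K u v) * hw u * gw v) = (case x of (u, v) \<Rightarrow> ?F (v, u))"
      if "x \<in> space (\<beta> \<Otimes>\<^sub>M \<beta>)" for x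
      using that sym by (auto simp: space_pair_measure sp)
    have "integrable (\<beta> \<Otimes>\<^sub>M \<beta>) (\<lambda>(u, v). ?F (v, u))"
      using GH BB.integrable_product_swap[of ?F] by (auto simp: kernel_form_defined_def)
    then show "integrable (\<beta> \<Otimes>\<^sub>M \<beta>) (\<lambda>(u, v). real_of_ereal (K u v) * hw u * gw v)"
      by (subst Bochner_Integration.integrable_cong[OF refl eq])
    have "kernel_form K \<beta> hw \<beta> gw = (\<integral>(u, v). ?F (v, u) \<partial>(\<beta> \<Otimes>\<^sub>M \<beta>))"
      unfolding kernel_form_def by (rule Bochner_Integration.integral_cong[OF refl eq])
    also have "\<dots> = kernel_form K \<beta> gw \<beta> hw"
      unfolding kernel_form_def by (rule BB.integral_product_swap) (simp add: split_beta')
    finally show "kernel_form K \<beta> hw \<beta> gw = kernel_form K \<beta> gw \<beta> hw" .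
  qed
  have swap_ae: "AE (u, v) in \<beta> \<Otimes>\<^sub>M \<beta>. hw u \<noteq> 0 \<and> gw v \<noteq> 0 \<longrightarrow> \<bar>K u v\<bar> \<noteq> \<infinity>"
  proof -
    \<comment> \<open>The product of \<beta> with itself is its own image under the exchange of
      coordinates, so an almost everywhere statement can be pulled back along it.\<close>
    have "AE (u, v) in distr (\<beta> \<Otimes>\<^sub>M \<beta>) (\<beta> \<Otimes>\<^sub>M \<beta>) (\<lambda>(x, y). (y, x)).
        gw u \<noteq> 0 \<and> hw v \<noteq> 0 \<longrightarrow> \<bar>K u v\<bar> \<noteq> \<infinity>"
      unfolding BB.distr_pair_swap[symmetric] using GH by (simp add: kernel_form_defined_def)
    then have "AE z in \<beta> \<Otimes>\<^sub>M \<beta>. case (case z of (x, y) \<Rightarrow> (y, x)) of (u, v) \<Rightarrow>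
        gw u \<noteq> 0 \<and> hw v \<noteq> 0 \<longrightarrow> \<bar>K u v\<bar> \<noteq> \<infinity>"
      by (rule AE_distrD[rotated]) simp
    then show ?thesis
      by (rule AE_mp) (rule AE_I2, use sym in \<open>auto simp: space_pair_measure sp\<close>)
  qed
  define w where "w x = gw x - hw x" for x
  have parts: "integrable (\<beta> \<Otimes>\<^sub>M \<beta>) (\<lambda>(u, v). real_of_ereal (K u v) * gw u * gw v)"
    "integrable (\<beta> \<Otimes>\<^sub>M \<beta>) (\<lambda>(u, v). real_of_ereal (K u v) * gw u * hw v)"
    "integrable (\<beta> \<Otimes>\<^sub>M \<beta>) (\<lambda>(u, v). real_of_ereal (K u v) * hw u * hw v)"
    using GG GH HH by (simp_all add: kernel_form_defined_def)
  have expand: "(\<lambda>(u, v). real_of_ereal (K u v) * w u * w v) =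
      (\<lambda>x. (case x of (u, v) \<Rightarrow> real_of_ereal (K u v) * gw u * gw v)
        - (case x of (u, v) \<Rightarrow> real_of_ereal (K u v) * gw u * hw v)
        - (case x of (u, v) \<Rightarrow> real_of_ereal (K u v) * hw u * gw v)
        + (case x of (u, v) \<Rightarrow> real_of_ereal (K u v) * hw u * hw v))"
    by (auto simp: fun_eq_iff w_def algebra_simps)
  have "0 \<le> (\<integral>(u, v). real_of_ereal (K u v) * w u * w v \<partial>(\<beta> \<Otimes>\<^sub>M \<beta>))"
  proof (rule positive_definite_kernel_signed_density[OF pd \<beta>X _ k'])
    show "integrable \<beta> w" unfolding w_def[abs_def] using gwi hwi by simp
    show "integrable (\<beta> \<Otimes>\<^sub>M \<beta>) (\<lambda>(u, v). real_of_ereal (K u v) * w u * w v)"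
      unfolding expand using parts swap_int unfolding split_beta' by simp
    \<comment> \<open>If \<open>w\<close> is nonzero at \<open>u\<close> and at \<open>v\<close>,
      then at each of the two points \<open>gw\<close> or \<open>hw\<close> is nonzero. The four
      resulting cases are covered by the four almost everywhere statements.\<close>
    show "AE (u, v) in \<beta> \<Otimes>\<^sub>M \<beta>. w u \<noteq> 0 \<and> w v \<noteq> 0 \<longrightarrow> \<bar>K u v\<bar> \<noteq> \<infinity>"
      using GG[unfolded kernel_form_defined_def, THEN conjunct2]
        GH[unfolded kernel_form_defined_def, THEN conjunct2]
        HH[unfolded kernel_form_defined_def, THEN conjunct2] swap_ae
      by eventually_elim (auto simp: w_def)
  qed
  also have "\<dots> = kernel_form K \<beta> gw \<beta> gw - kernel_form K \<beta> gw \<beta> hw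
      - kernel_form K \<beta> hw \<beta> gw + kernel_form K \<beta> hw \<beta> hw"
    unfolding expand kernel_form_def using parts swap_int unfolding split_beta' by simp
  finally show ?thesis using e swap_eq by simp
qed

section \<open>Finiteness of the kernel almost everywhere for a product of two measures\<close>

text \<open>
  Measurability of the diagonal is not automatic, as the ambient metric space need not be
  second countable.
\<close>

lemma compact_diagonal_measurable:
  fixes X :: "'a::metric_space set"
  assumes "compact X"
  shows "(\<lambda>x. (x, x)) ` X \<in> sets (restrict_space borel X \<Otimes>\<^sub>M restrict_space borel X)"
proof -
  have "\<exists>C. finite C \<and> X \<subseteq> (\<Union>x\<in>C. ball x (inverse (real (Suc n))))" for n
  proof -
    have "\<forall>\<epsilon>>0. \<exists>C. finite C \<and> C \<subseteq> X \<and> X \<subseteq> (\<Union>x\<in>C. ball x \<epsilon>)"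
      using assms by (intro seq_compact_imp_totally_bounded) (simp add: compact_eq_seq_compact_metric)
    from this[rule_format, of "inverse (real (Suc n))"] show ?thesis by auto
  qed
  then obtain C where C: "\<And>n. finite (C n)" "\<And>n. X \<subseteq> (\<Union>x\<in>C n. ball x (inverse (real (Suc n))))"
    by metis
  let ?B = "\<lambda>c n. X \<inter> ball c (inverse (real (Suc n)))"
  \<comment> \<open>Compactness provides finite covers by balls of radius 1/(n+1). Two points in a
    common ball of the n-th cover are closer than 2/(n+1), so only diagonal points lie in every one
    of these finite unions of measurable squares.\<close>
  have "(\<lambda>x. (x, x)) ` X = (\<Inter>n. \<Union>c\<in>C n. ?B c n \<times> ?B c n)"
  proof (intro equalityI subsetI)
    fix z assume "z \<in> (\<lambda>x. (x, x)) ` X"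
    then obtain x where x: "x \<in> X" "z = (x, x)" by blast
    have "z \<in> (\<Union>c\<in>C n. ?B c n \<times> ?B c n)" for n
      using C(2)[of n] x by blast
    then show "z \<in> (\<Inter>n. \<Union>c\<in>C n. ?B c n \<times> ?B c n)" by blast
  next
    fix z assume z: "z \<in> (\<Inter>n. \<Union>c\<in>C n. ?B c n \<times> ?B c n)"
    obtain x y where xy: "z = (x, y)" by (cases z)
    have "dist x y < 2 * inverse (real (Suc n))" for n
    proof -
      have "(x, y) \<in> (\<Union>c\<in>C n. ?B c n \<times> ?B c n)" using z xy by blast
      then obtain c where "dist c x < inverse (real (Suc n))" "dist c y < inverse (real (Suc n))"
        by auto
      then show ?thesis using dist_triangle2[of x y c] by (simp add: dist_commute)
    qed
    moreover have "\<exists>n. 2 * inverse (real (Suc n)) < dist x y" if "x \<noteq> y"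
      using reals_Archimedean[of "dist x y / 2"] that by (auto simp: field_simps)
    ultimately have "x = y" by (metis less_asym)
    moreover have "x \<in> X" using z xy by auto
    ultimately show "z \<in> (\<lambda>x. (x, x)) ` X" using xy by auto
  qed
  moreover have "?B c n \<in> sets (restrict_space borel X)" for c n
    by (auto simp: sets_restrict_space)
  ultimately show ?thesis
    using C(1) by (auto intro!: sets.countable_INT sets.finite_UN pair_measureI)
qed

text \<open>
  \<open>K\<close> is infinite at most on the diagonal, and there not at an atom of \<open>\<nu>\<close>, since otherwise it
  would be infinite on a set of positive \<open>\<nu> \<otimes> \<nu>\<close> measure.
\<close>

lemma AE_finite_off_diagonal_kernel:
  fixes X :: "'a::metric_space set"
  assumes "compact X" and "finite_borel_measure_on X \<xi>" and "finite_borel_measure_on X \<nu>"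
    and off: "\<And>u v. u \<in> X \<Longrightarrow> v \<in> X \<Longrightarrow> u \<noteq> v \<Longrightarrow> \<bar>K u v\<bar> \<noteq> (\<infinity>::ereal)"
    and ae: "AE (u, v) in \<nu> \<Otimes>\<^sub>M \<nu>. \<bar>K u v\<bar> \<noteq> \<infinity>"
  shows "AE (u, v) in \<xi> \<Otimes>\<^sub>M \<nu>. \<bar>K u v\<bar> \<noteq> \<infinity>"
proof -
  have s: "sets \<xi> = sets (restrict_space borel X)" "sets \<nu> = sets (restrict_space borel X)"
    and "finite_measure \<xi>" "finite_measure \<nu>"
    using assms by (auto simp: finite_borel_measure_on_def)
  interpret F: finite_measure \<xi> by fact
  interpret N: finite_measure \<nu> by fact
  interpret FN: pair_sigma_finite \<xi> \<nu> ..
  have sp: "space \<xi> = X" "space \<nu> = X"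
    using s[THEN sets_eq_imp_space_eq] by (auto simp: space_restrict_space)
  have ss: "sets (\<xi> \<Otimes>\<^sub>M \<nu>) = sets (restrict_space borel X \<Otimes>\<^sub>M restrict_space borel X)"
    "sets (\<nu> \<Otimes>\<^sub>M \<nu>) = sets (restrict_space borel X \<Otimes>\<^sub>M restrict_space borel X)"
    using s by (auto intro!: sets_pair_measure_cong)
  obtain Z where Z: "{z \<in> space (\<nu> \<Otimes>\<^sub>M \<nu>). \<not> (case z of (u, v) \<Rightarrow> \<bar>K u v\<bar> \<noteq> \<infinity>)} \<subseteq> Z"
      "emeasure (\<nu> \<Otimes>\<^sub>M \<nu>) Z = 0" "Z \<in> sets (\<nu> \<Otimes>\<^sub>M \<nu>)"
    using ae by (rule AE_E)
  \<comment> \<open>The set where \<open>K\<close> is infinite is not known to be measurable.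
    \<open>E\<close> is a measurable set that contains its part in X \<times> X: the null cover
    \<open>Z\<close> cut with the diagonal.\<close>
  define E where "E = Z \<inter> (\<lambda>x. (x, x)) ` X"
  have E: "E \<in> sets (\<xi> \<Otimes>\<^sub>M \<nu>)"
    using Z(3) compact_diagonal_measurable[OF assms(1)] ss by (auto simp: E_def)
  \<comment> \<open>The section of \<open>E\<close> at \<open>u\<close> is contained in {u}. The
    claim is made for every \<open>u\<close>, not for \<nu>-almost every one, since \<xi> may charge
    \<nu>-null sets.\<close>
  have null: "AE v in \<nu>. (u, v) \<notin> E" if u: "u \<in> X" for u
  proof -
    have us: "{u} \<in> sets \<nu>"
      using u unfolding s(2) sets_restrict_space by (intro image_eqI[of _ _ "{u}"]) auto
    show ?thesis
    proof (cases "emeasure \<nu> {u} = 0")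
      case True
      then have "AE v in \<nu>. v \<notin> {u}" using us by (intro AE_not_in) (auto simp: null_sets_def)
      then show ?thesis by eventually_elim (auto simp: E_def)
    next
      case False
      have "emeasure (\<nu> \<Otimes>\<^sub>M \<nu>) ({u} \<times> {u}) = emeasure \<nu> {u} * emeasure \<nu> {u}"
        by (rule N.emeasure_pair_measure_Times[OF us us])
      then have "\<not> {u} \<times> {u} \<subseteq> Z"
        using False Z(2,3) emeasure_mono[of "{u} \<times> {u}" Z "\<nu> \<Otimes>\<^sub>M \<nu>"] by auto
      then show ?thesis by (auto simp: E_def)
    qed
  qed
  have "AE z in \<xi> \<Otimes>\<^sub>M \<nu>. z \<notin> E"
  proof (rule FN.AE_pair_measure)
    show "{x \<in> space (\<xi> \<Otimes>\<^sub>M \<nu>). x \<notin> E} \<in> sets (\<xi> \<Otimes>\<^sub>M \<nu>)" using E by auto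
    show "AE u in \<xi>. AE v in \<nu>. (u, v) \<notin> E" using null sp by auto
  qed
  have "\<bar>K u v\<bar> \<noteq> \<infinity>" if "u \<in> X" "v \<in> X" "(u, v) \<notin> E" for u v
  proof
    assume inf: "\<bar>K u v\<bar> = \<infinity>"
    then have "u = v" using off[OF that(1,2)] by argo
    moreover have "(u, v) \<in> Z"
      by (rule subsetD[OF Z(1)]) (simp add: space_pair_measure sp that inf del: abs_ereal.simps)
    ultimately show False using that by (simp add: E_def)
  qed
  note fin = this
  show ?thesis
    using \<open>AE z in \<xi> \<Otimes>\<^sub>M \<nu>. z \<notin> E\<close> AE_space
  proof eventually_elim
    case (elim z)
    then show ?case using fin[of "fst z" "snd z"] by (simp add: split_beta' space_pair_measure sp mem_Times_iff)
  qed
qed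

section \<open>Mixed energy with a signed measure of known potential\<close>

text \<open>
  The double integral of \<open>K\<close> against \<open>g d\<xi>\<close> and \<open>h d\<nu>\<close> need not converge absolutely, although
  the iterated integral exists. Hence \<open>\<xi>\<close> is first restricted to the sets where
  \<open>\<integral> |K(u,v) h(v)| \<nu>(dv) \<le> n\<close>, which exhaust \<open>X\<close> because this integral is finite at every point.
\<close>

lemma kernel_form_eigen_bound:
  fixes g h T :: "'a::metric_space \<Rightarrow> real"
  assumes pd: "positive_definite_kernel X K"
    and sym: "\<And>u v. u \<in> X \<Longrightarrow> v \<in> X \<Longrightarrow> K u v = K v u"
    and \<xi>: "finite_borel_measure_on X \<xi>" and \<nu>: "finite_borel_measure_on X \<nu>"
    and k: "(\<lambda>(u, v). real_of_ereal (K u v)) \<in> borel_measurable (\<nu> \<Otimes>\<^sub>M \<nu>)"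
    and ae: "AE (u, v) in \<xi> \<Otimes>\<^sub>M \<nu>. \<bar>K u v\<bar> \<noteq> \<infinity>"
    and g: "integrable \<xi> g" and h: "integrable \<nu> h"
    and gg: "kernel_form_defined K \<xi> g \<xi> g"
    and hh: "kernel_form_defined K \<nu> h \<nu> h"
    and Ti: "\<And>u. u \<in> X \<Longrightarrow> integrable \<nu> (\<lambda>v. real_of_ereal (K u v) * h v)"
    and T: "\<And>u. u \<in> X \<Longrightarrow> (\<integral>v. real_of_ereal (K u v) * h v \<partial>\<nu>) = T u"
    and gT: "integrable \<xi> (\<lambda>u. g u * T u)"
  shows "2 * (\<integral>u. g u * T u \<partial>\<xi>) \<le> kernel_form K \<xi> g \<xi> g + kernel_form K \<nu> h \<nu> h"
proof -
  have fin: "finite_measure \<xi>" "finite_measure \<nu>"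
    and s: "sets \<xi> = sets (restrict_space borel X)" "sets \<nu> = sets (restrict_space borel X)"
    using \<xi> \<nu> by (auto simp: finite_borel_measure_on_def)
  interpret F: finite_measure \<xi> by fact
  interpret N: finite_measure \<nu> by fact
  interpret FN: pair_sigma_finite \<xi> \<nu> ..
  have sp: "space \<xi> = X"
    using s(1)[THEN sets_eq_imp_space_eq] by (simp add: space_restrict_space)
  let ?k = "\<lambda>u v. real_of_ereal (K u v)"
  have [measurable]: "(\<lambda>(u, v). ?k u v) \<in> borel_measurable (\<xi> \<Otimes>\<^sub>M \<nu>)"
      "(\<lambda>(u, v). ?k u v) \<in> borel_measurable (\<xi> \<Otimes>\<^sub>M \<xi>)"
    using k s by (simp_all cong: sets_pair_measure_cong measurable_cong_sets)
  have [measurable]: "g \<in> borel_measurable \<xi>" "h \<in> borel_measurable \<nu>" using g h by auto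
  \<comment> \<open>On \<open>X\<close> the hypothesis \<open>Ti\<close> makes this a genuine
    integral. Otherwise the default value 0 of a divergent Bochner integral could place
    \<open>u\<close> in \<open>A n\<close> without any bound being available.\<close>
  define S where "S u = (\<integral>v. \<bar>?k u v * h v\<bar> \<partial>\<nu>)" for u
  have [measurable]: "S \<in> borel_measurable \<xi>" unfolding S_def[abs_def] by measurable
  define A where "A n = {u \<in> space \<xi>. S u \<le> real n}" for n
  have A[measurable]: "A n \<in> sets \<xi>" for n unfolding A_def by measurable
  define gn where "gn n u = indicator (A n) u * g u" for n u
  have [measurable]: "gn n \<in> borel_measurable \<xi>" for n unfolding gn_def[abs_def] by measurable
  have gn_le: "\<bar>gn n u\<bar> \<le> \<bar>g u\<bar>" for n u by (auto simp: gn_def indicator_def)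
  have gn_eq: "\<exists>N. \<forall>n\<ge>N. gn n u = g u" if "u \<in> X" for u
  proof -
    obtain N where "S u \<le> real N" using real_arch_simple by blast
    then show ?thesis using that by (intro exI[of _ N]) (auto simp: gn_def A_def sp)
  qed
  have gn_int: "integrable \<xi> (gn n)" for n
    by (rule Bochner_Integration.integrable_bound[OF g]) (auto simp: gn_le)
  have gg_int: "integrable (\<xi> \<Otimes>\<^sub>M \<xi>) (\<lambda>(u, v). ?k u v * g u * g v)"
    using gg by (simp add: kernel_form_defined_def)
  have gn_gn_bound: "norm (case x of (u, v) \<Rightarrow> ?k u v * gn n u * gn n v)
      \<le> norm (case x of (u, v) \<Rightarrow> ?k u v * g u * g v)" for n x
    by (cases x) (auto simp: gn_def abs_mult indicator_def real_of_ereal_pos)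
  have gn_gn: "kernel_form_defined K \<xi> (gn n) \<xi> (gn n)" for n
    unfolding kernel_form_defined_def
  proof
    show "integrable (\<xi> \<Otimes>\<^sub>M \<xi>) (\<lambda>(u, v). ?k u v * gn n u * gn n v)"
      by (rule Bochner_Integration.integrable_bound[OF gg_int])
        (measurable, rule AE_I2, rule gn_gn_bound)
    show "AE (u, v) in \<xi> \<Otimes>\<^sub>M \<xi>. gn n u \<noteq> 0 \<and> gn n v \<noteq> 0 \<longrightarrow> \<bar>K u v\<bar> \<noteq> \<infinity>"
      using gg[unfolded kernel_form_defined_def, THEN conjunct2]
      by eventually_elim (auto simp: gn_def)
  qed
  have cross_int: "integrable (\<xi> \<Otimes>\<^sub>M \<nu>) (\<lambda>(u, v). ?k u v * gn n u * h v)" for n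
  proof (rule FN.Fubini_integrable)
    show "(\<lambda>(u, v). ?k u v * gn n u * h v) \<in> borel_measurable (\<xi> \<Otimes>\<^sub>M \<nu>)" by measurable
    have "(\<integral>v. norm (case (u, v) of (u, v) \<Rightarrow> ?k u v * gn n u * h v) \<partial>\<nu>) = \<bar>gn n u\<bar> * S u" for u
    proof -
      have "(\<integral>v. norm (case (u, v) of (u, v) \<Rightarrow> ?k u v * gn n u * h v) \<partial>\<nu>)
          = (\<integral>v. \<bar>gn n u\<bar> * \<bar>?k u v * h v\<bar> \<partial>\<nu>)"
        by (rule Bochner_Integration.integral_cong) (auto simp: abs_mult mult_ac)
      then show ?thesis by (simp add: S_def)
    qed
    \<comment> \<open>On \<open>A n\<close> the factor \<open>S\<close> is at most n, and off
      \<open>A n\<close> the truncation \<open>gn n\<close> vanishes. This is where the truncation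
      makes the double integral converge absolutely.\<close>
    moreover have "integrable \<xi> (\<lambda>u. \<bar>gn n u\<bar> * S u)"
    proof (rule Bochner_Integration.integrable_bound)
      show "integrable \<xi> (\<lambda>u. real n * gn n u)" using gn_int by simp
      have "0 \<le> S u" for u unfolding S_def by simp
      then show "AE u in \<xi>. norm (\<bar>gn n u\<bar> * S u) \<le> norm (real n * gn n u)"
        by (intro AE_I2) (auto simp: gn_def A_def indicator_def abs_mult mult_ac intro!: mult_right_mono)
    qed measurable
    ultimately show "integrable \<xi> (\<lambda>u. \<integral>v. norm (case (u, v) of (u, v) \<Rightarrow> ?k u v * gn n u * h v) \<partial>\<nu>)"
      by simp
    have "integrable \<nu> (\<lambda>v. case (u, v) of (u, v) \<Rightarrow> ?k u v * gn n u * h v)" if "u \<in> X" for u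
      using integrable_mult_left[OF Ti[OF that], of "gn n u"] by (simp add: mult_ac)
    then show "AE u in \<xi>. integrable \<nu> (\<lambda>v. case (u, v) of (u, v) \<Rightarrow> ?k u v * gn n u * h v)"
      by (intro AE_I2) (simp add: sp)
  qed
  have cross: "kernel_form_defined K \<xi> (gn n) \<nu> h" for n
    unfolding kernel_form_defined_def
    by (rule conjI[OF cross_int]) (use ae in eventually_elim, auto)
  have cross_eq: "kernel_form K \<xi> (gn n) \<nu> h = (\<integral>u. gn n u * T u \<partial>\<xi>)" for n
  proof -
    have "kernel_form K \<xi> (gn n) \<nu> h = (\<integral>u. \<integral>v. ?k u v * gn n u * h v \<partial>\<nu> \<partial>\<xi>)"
      unfolding kernel_form_def using FN.integral_fst'[OF cross_int[of n]] by simp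
    also have "\<dots> = (\<integral>u. gn n u * T u \<partial>\<xi>)"
    proof (rule Bochner_Integration.integral_cong[OF refl])
      fix u assume "u \<in> space \<xi>"
      then have "gn n u * T u = (\<integral>v. gn n u * (?k u v * h v) \<partial>\<nu>)" by (simp add: T sp)
      then show "(\<integral>v. ?k u v * gn n u * h v \<partial>\<nu>) = gn n u * T u" by (simp add: mult_ac)
    qed
    finally show ?thesis .
  qed
  have le: "2 * (\<integral>u. gn n u * T u \<partial>\<xi>)
      \<le> kernel_form K \<xi> (gn n) \<xi> (gn n) + kernel_form K \<nu> h \<nu> h" for n
    using kernel_form_cross_le[OF pd sym \<xi> \<nu> k gn_int h gn_gn cross hh] by (simp add: cross_eq)
  \<comment> \<open>On \<open>X\<close> the potential \<open>T\<close> is a parameter integral of a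
    jointly measurable function, which gives its measurability.\<close>
  have Tm: "T \<in> borel_measurable \<xi>"
  proof -
    have "(\<lambda>u. \<integral>v. ?k u v * h v \<partial>\<nu>) \<in> borel_measurable \<xi>" by measurable
    then show ?thesis using T sp by (subst measurable_cong[of _ _ "\<lambda>u. \<integral>v. ?k u v * h v \<partial>\<nu>"]) auto
  qed
  \<comment> \<open>The truncation is removed by dominated convergence on both sides of
    \<open>le\<close>: at each point of \<open>X\<close> the truncated weight eventually equals
    \<open>g\<close>, and the untruncated integrands dominate.\<close>
  have lim1: "(\<lambda>n. \<integral>u. gn n u * T u \<partial>\<xi>) \<longlonglongrightarrow> (\<integral>u. g u * T u \<partial>\<xi>)"
  proof (rule integral_dominated_convergence[where w="\<lambda>u. \<bar>g u * T u\<bar>"])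
    show "AE u in \<xi>. (\<lambda>n. gn n u * T u) \<longlonglongrightarrow> g u * T u"
    proof (rule AE_I2)
      fix u assume "u \<in> space \<xi>"
      then obtain N where "\<forall>n\<ge>N. gn n u = g u" using gn_eq sp by blast
      then show "(\<lambda>n. gn n u * T u) \<longlonglongrightarrow> g u * T u"
        by (intro tendsto_eventually) (auto simp: eventually_sequentially)
    qed
    show "AE u in \<xi>. norm (gn n u * T u) \<le> \<bar>g u * T u\<bar>" for n
      by (rule AE_I2) (auto simp: abs_mult intro!: mult_right_mono gn_le)
  qed (use gT Tm in auto)
  have lim2: "(\<lambda>n. kernel_form K \<xi> (gn n) \<xi> (gn n)) \<longlonglongrightarrow> kernel_form K \<xi> g \<xi> g"
    unfolding kernel_form_def
  proof (rule integral_dominated_convergence[where w="\<lambda>x. norm (case x of (u, v) \<Rightarrow> ?k u v * g u * g v)"])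
    show "AE x in \<xi> \<Otimes>\<^sub>M \<xi>. (\<lambda>n. case x of (u, v) \<Rightarrow> ?k u v * gn n u * gn n v)
        \<longlonglongrightarrow> (case x of (u, v) \<Rightarrow> ?k u v * g u * g v)"
    proof (rule AE_I2)
      fix x assume x: "x \<in> space (\<xi> \<Otimes>\<^sub>M \<xi>)"
      obtain u v where uv: "x = (u, v)" by (cases x)
      then have "u \<in> X" "v \<in> X" using x by (auto simp: space_pair_measure sp)
      then obtain N N' where "\<forall>n\<ge>N. gn n u = g u" "\<forall>n\<ge>N'. gn n v = g v" using gn_eq by meson
      then have "\<forall>n\<ge>max N N'. gn n u = g u \<and> gn n v = g v" by simp
      then show "(\<lambda>n. case x of (u, v) \<Rightarrow> ?k u v * gn n u * gn n v)
        \<longlonglongrightarrow> (case x of (u, v) \<Rightarrow> ?k u v * g u * g v)"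
        unfolding uv prod.case
        by (intro tendsto_eventually) (unfold eventually_sequentially, rule exI[of _ "max N N'"], simp)
    qed
    show "integrable (\<xi> \<Otimes>\<^sub>M \<xi>) (\<lambda>x. norm (case x of (u, v) \<Rightarrow> ?k u v * g u * g v))"
      using gg_int by (rule integrable_norm)
    show "AE x in \<xi> \<Otimes>\<^sub>M \<xi>. norm (case x of (u, v) \<Rightarrow> ?k u v * gn n u * gn n v)
      \<le> norm (case x of (u, v) \<Rightarrow> ?k u v * g u * g v)" for n
      by (rule AE_I2) (rule gn_gn_bound)
  qed measurable
  show ?thesis
  proof (rule LIMSEQ_le)
    show "(\<lambda>n. 2 * (\<integral>u. gn n u * T u \<partial>\<xi>)) \<longlonglongrightarrow> 2 * (\<integral>u. g u * T u \<partial>\<xi>)"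
      by (intro tendsto_intros lim1)
    show "(\<lambda>n. kernel_form K \<xi> (gn n) \<xi> (gn n) + kernel_form K \<nu> h \<nu> h)
      \<longlonglongrightarrow> kernel_form K \<xi> g \<xi> g + kernel_form K \<nu> h \<nu> h"
      by (intro tendsto_intros lim2)
    show "\<exists>N. \<forall>n\<ge>N. 2 * (\<integral>u. gn n u * T u \<partial>\<xi>)
      \<le> kernel_form K \<xi> (gn n) \<xi> (gn n) + kernel_form K \<nu> h \<nu> h" using le by blast
  qed
qed

section \<open>Matrix inverses and coordinate expansions of bilinear forms\<close>

lemma matrix_inv_works:
  fixes A :: "real ^ 'n ^ 'n"
  assumes "invertible A"
  shows "A ** matrix_inv A = mat 1" "matrix_inv A ** A = mat 1"
  using someI_ex[OF assms[unfolded invertible_def]] unfolding matrix_inv_def by auto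

lemma matrix_inv_symmetric:
  fixes A :: "real ^ 'n ^ 'n"
  assumes "invertible A" "transpose A = A"
  shows "transpose (matrix_inv A) = matrix_inv A"
proof -
  have "transpose (matrix_inv A) ** A = mat 1"
    using arg_cong[OF matrix_inv_works(1)[OF assms(1)], of transpose] assms(2)
    by (simp add: matrix_transpose_mul)
  then have "transpose (matrix_inv A) ** A ** matrix_inv A = mat 1 ** matrix_inv A" by simp
  then show ?thesis by (simp add: matrix_mul_assoc[symmetric] matrix_inv_works(1)[OF assms(1)])
qed

lemma transpose_diff: "transpose (A - B) = transpose A - transpose (B :: real ^ 'n ^ 'm)"
  by (simp add: transpose_def vec_eq_iff)

lemma inner_matrix_sum: "a \<bullet> (A *v b) = (\<Sum>i\<in>UNIV. \<Sum>j\<in>UNIV. a $ i * b $ j * A $ i $ j)"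
  for A :: "real ^ 'n ^ 'm"
  by (simp add: inner_vec_def matrix_vector_mult_def sum_distrib_left mult_ac)

lemma inner_product_sum:
  "(a \<bullet> x) * (b \<bullet> y) = (\<Sum>i\<in>UNIV. \<Sum>j\<in>UNIV. a $ i * b $ j * (x $ i * y $ j))"
  for a x :: "real ^ 'n" and b y :: "real ^ 'm"
  unfolding inner_vec_def inner_real_def sum_product
  by (intro sum.cong refl) (simp add: mult_ac)

section \<open>The matrices M, B and D as bilinear forms\<close>

lemma M_mat_form:
  fixes f :: "'a \<Rightarrow> real ^ 'm"
  assumes "\<And>i j. integrable \<xi> (\<lambda>u. f u $ i * f u $ j)"
  shows "integrable \<xi> (\<lambda>u. (a \<bullet> f u) * (b \<bullet> f u))"
    and "(\<integral>u. (a \<bullet> f u) * (b \<bullet> f u) \<partial>\<xi>) = a \<bullet> (M_mat f \<xi> *v b)"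
  using assms by (simp_all add: inner_product_sum inner_matrix_sum M_mat_def)

lemma M_mat_symmetric: "transpose (M_mat f \<xi>) = M_mat f \<xi>"
  by (simp add: M_mat_def transpose_def vec_eq_iff mult.commute)

text \<open>Integrals follow from the entries by bilinearity. For finiteness of \<open>K\<close>, a
  nonzero value of a linear combination of the components of \<open>f\<close> forces some component
  to be nonzero, and finiteness of the corresponding entry then forces \<open>K\<close> to be
  finite.\<close>

lemma B_mat_form:
  fixes f :: "'a \<Rightarrow> real ^ 'm"
  assumes B: "\<And>i j. ereal_integrable (\<xi> \<Otimes>\<^sub>M \<xi>) (\<lambda>(u, v). K u v * ereal (f u $ i) * ereal (f v $ j))"
  shows "kernel_form_defined K \<xi> (\<lambda>u. a \<bullet> f u) \<xi> (\<lambda>u. b \<bullet> f u)"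
    and "kernel_form K \<xi> (\<lambda>u. a \<bullet> f u) \<xi> (\<lambda>u. b \<bullet> f u) = a \<bullet> (B_mat K f \<xi> *v b)"
proof -
  let ?k = "\<lambda>u v. real_of_ereal (K u v)"
  have int: "integrable (\<xi> \<Otimes>\<^sub>M \<xi>) (\<lambda>x. ?k (fst x) (snd x) * (f (fst x) $ i * f (snd x) $ j))" for i j
    using B[of i j] by (simp add: ereal_integrable_def split_beta' mult.assoc)
  have expand: "(\<lambda>(u, v). ?k u v * (a \<bullet> f u) * (b \<bullet> f v)) = (\<lambda>x. \<Sum>i\<in>UNIV. \<Sum>j\<in>UNIV.
      a $ i * b $ j * (?k (fst x) (snd x) * (f (fst x) $ i * f (snd x) $ j)))"
    by (simp add: fun_eq_iff mult.assoc inner_product_sum sum_distrib_left mult.left_commute)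
  have ae: "AE x in \<xi> \<Otimes>\<^sub>M \<xi>. \<forall>i j. \<bar>case x of (u, v) \<Rightarrow> K u v * ereal (f u $ i) * ereal (f v $ j)\<bar> \<noteq> \<infinity>"
    unfolding AE_all_countable using B[unfolded ereal_integrable_def, THEN conjunct1] by (intro allI)
  \<comment> \<open>The real factors must be nonzero, because the convention \<infinity> * 0 = 0
    would hide an infinite \<open>k\<close>.\<close>
  have inf: "\<bar>k * ereal p * ereal q\<bar> = \<infinity>" if "\<bar>k\<bar> = \<infinity>" "p \<noteq> 0" "q \<noteq> 0" for k p q
    using that by (cases k; cases "0 < p"; cases "0 < q") auto
  have comp: "\<exists>i. x $ i \<noteq> 0" if "c \<bullet> x \<noteq> 0" for c x :: "real ^ 'm"
    using that by (metis inner_zero_right vec_eq_iff zero_index)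
  show "kernel_form_defined K \<xi> (\<lambda>u. a \<bullet> f u) \<xi> (\<lambda>u. b \<bullet> f u)"
    unfolding kernel_form_defined_def
  proof
    show "integrable (\<xi> \<Otimes>\<^sub>M \<xi>) (\<lambda>(u, v). ?k u v * (a \<bullet> f u) * (b \<bullet> f v))"
      unfolding expand using int by simp
    show "AE (u, v) in \<xi> \<Otimes>\<^sub>M \<xi>. a \<bullet> f u \<noteq> 0 \<and> b \<bullet> f v \<noteq> 0 \<longrightarrow> \<bar>K u v\<bar> \<noteq> \<infinity>"
      using ae
    proof eventually_elim
      case (elim x)
      obtain u v where x: "x = (u, v)" by (cases x)
      have "\<bar>K u v\<bar> \<noteq> \<infinity>" if ab: "a \<bullet> f u \<noteq> 0" "b \<bullet> f v \<noteq> 0"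
      proof
        assume k: "\<bar>K u v\<bar> = \<infinity>"
        obtain i j where "f u $ i \<noteq> 0" "f v $ j \<noteq> 0" using comp[OF ab(1)] comp[OF ab(2)] by blast
        from inf[OF k this] elim[rule_format, of i j] show False by (simp add: x)
      qed
      then show ?case by (simp add: x)
    qed
  qed
  show "kernel_form K \<xi> (\<lambda>u. a \<bullet> f u) \<xi> (\<lambda>u. b \<bullet> f u) = a \<bullet> (B_mat K f \<xi> *v b)"
    unfolding kernel_form_def expand using int
    by (simp add: inner_matrix_sum B_mat_def ereal_integral_def split_beta' mult.assoc)
qed

lemma B_mat_symmetric:
  assumes "finite_measure \<xi>"
    and sym: "\<And>u v. u \<in> space \<xi> \<Longrightarrow> v \<in> space \<xi> \<Longrightarrow> K u v = K v u"
    and B: "\<And>i j. ereal_integrable (\<xi> \<Otimes>\<^sub>M \<xi>) (\<lambda>(u, v). K u v * ereal (f u $ i) * ereal (f v $ j))"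
  shows "transpose (B_mat K f \<xi>) = B_mat K f \<xi>"
proof -
  interpret finite_measure \<xi> by fact
  interpret pair_sigma_finite \<xi> \<xi> ..
  let ?F = "\<lambda>i j (u, v). real_of_ereal (K u v) * f u $ i * f v $ j"
  have F: "B_mat K f \<xi> $ i $ j = integral\<^sup>L (\<xi> \<Otimes>\<^sub>M \<xi>) (?F i j)" for i j
    by (simp add: B_mat_def ereal_integral_def split_beta')
  have "integral\<^sup>L (\<xi> \<Otimes>\<^sub>M \<xi>) (?F i j) = integral\<^sup>L (\<xi> \<Otimes>\<^sub>M \<xi>) (?F j i)" for i j
  proof -
    have "?F i j \<in> borel_measurable (\<xi> \<Otimes>\<^sub>M \<xi>)"
      using B[of i j] by (auto simp: ereal_integrable_def split_beta' dest: borel_measurable_integrable)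
    then have "integral\<^sup>L (\<xi> \<Otimes>\<^sub>M \<xi>) (?F i j) = (\<integral>(x, y). ?F i j (y, x) \<partial>(\<xi> \<Otimes>\<^sub>M \<xi>))"
      by (rule integral_product_swap[symmetric])
    also have "\<dots> = integral\<^sup>L (\<xi> \<Otimes>\<^sub>M \<xi>) (?F j i)"
    proof (rule Bochner_Integration.integral_cong[OF refl])
      fix x assume x: "x \<in> space (\<xi> \<Otimes>\<^sub>M \<xi>)"
      obtain u v where uv: "x = (u, v)" by (cases x)
      have "K u v = K v u" using x uv by (intro sym) (auto simp: space_pair_measure)
      then show "(case x of (x, y) \<Rightarrow> ?F i j (y, x)) = ?F j i x" by (simp add: uv mult_ac)
    qed
    finally show ?thesis .
  qed
  then show ?thesis by (simp add: transpose_def vec_eq_iff F)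
qed

text \<open>The information matrix is symmetric, hence so is its inverse. The left factor of the
  inverse can therefore be moved onto the left \<open>z\<close>, which exhibits the variance as the
  energy with coefficient vector M(\<xi>)^-1 z.\<close>

lemma D_mat_form:
  fixes f :: "'a \<Rightarrow> real ^ 'm"
  assumes "invertible (M_mat f \<xi>)"
  shows "z \<bullet> (D_mat K f \<xi> *v z)
    = (matrix_inv (M_mat f \<xi>) *v z) \<bullet> (B_mat K f \<xi> *v (matrix_inv (M_mat f \<xi>) *v z))"
proof -
  let ?N = "matrix_inv (M_mat f \<xi>)"
  have "z \<bullet> (D_mat K f \<xi> *v z) = (z v* ?N) \<bullet> (B_mat K f \<xi> *v (?N *v z))"
    by (simp add: D_mat_def dot_lmul_matrix matrix_vector_mul_assoc matrix_mul_assoc)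
  also have "z v* ?N = ?N *v z"
    using matrix_inv_symmetric[OF assms M_mat_symmetric] transpose_matrix_vector[of ?N z] by simp
  finally show ?thesis .
qed

lemma D_mat_symmetric:
  assumes "invertible (M_mat f \<xi>)" "transpose (B_mat K f \<xi>) = B_mat K f \<xi>"
  shows "transpose (D_mat K f \<xi>) = D_mat K f \<xi>"
  using assms matrix_inv_symmetric[OF assms(1) M_mat_symmetric]
  by (simp add: D_mat_def matrix_transpose_mul matrix_mul_assoc)

section \<open>Invariance of the span of the regression functions under the integral
  operator\<close>

text \<open>In the coordinates given by the eigenfunctions the operator is diagonal. The
  coefficients \<open>b v* L\<close> are multiplied by the eigenvalues and carried back to the
  components of \<open>f\<close> by the inverse of \<open>L\<close>. The pointwise eigenvalue
  equations make the identity hold at every point of \<open>X\<close>, as needed for designs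
  unrelated to \<nu>.\<close>

lemma integral_operator_eigenfunction_span:
  fixes f :: "'a \<Rightarrow> real ^ 'm::finite" and L :: "real ^ 'm ^ 'm"
  assumes sp: "space \<nu> = X"
    and eig: "\<And>k. eigenpair X \<nu> K (c k) (\<psi> k)"
    and L: "invertible L" and f: "\<And>x. x \<in> X \<Longrightarrow> f x = L *v (\<chi> k. \<psi> k x)"
  shows "\<exists>d. \<forall>u\<in>X. integrable \<nu> (\<lambda>v. real_of_ereal (K u v) * (b \<bullet> f v)) \<and>
    (\<integral>v. real_of_ereal (K u v) * (b \<bullet> f v) \<partial>\<nu>) = d \<bullet> f u"
proof -
  let ?c = "b v* L"
  obtain N where N: "N ** L = mat 1" using L by (auto simp: invertible_def)
  define e :: "real ^ 'm" where "e = (\<chi> k. ?c $ k * c k)"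
  have "integrable \<nu> (\<lambda>v. real_of_ereal (K u v) * (b \<bullet> f v)) \<and>
    (\<integral>v. real_of_ereal (K u v) * (b \<bullet> f v) \<partial>\<nu>) = (e v* N) \<bullet> f u" if u: "u \<in> X" for u
  proof -
    have int: "integrable \<nu> (\<lambda>v. real_of_ereal (K u v) * \<psi> k v)"
      and val: "(\<integral>v. real_of_ereal (K u v) * \<psi> k v \<partial>\<nu>) = c k * \<psi> k u" for k
      using eig[of k] u
      by (auto simp: eigenpair_def ereal_integrable_def integral_op_def ereal_integral_def)
    have eq: "real_of_ereal (K u v) * (b \<bullet> f v) =
        (\<Sum>k\<in>UNIV. ?c $ k * (real_of_ereal (K u v) * \<psi> k v))" if "v \<in> space \<nu>" for v
    proof -
      have "b \<bullet> f v = ?c \<bullet> (\<chi> k. \<psi> k v)" using that by (simp add: sp f dot_lmul_matrix)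
      then show ?thesis by (simp add: inner_vec_def sum_distrib_left mult.left_commute)
    qed
    have "(\<integral>v. real_of_ereal (K u v) * (b \<bullet> f v) \<partial>\<nu>)
        = (\<integral>v. (\<Sum>k\<in>UNIV. ?c $ k * (real_of_ereal (K u v) * \<psi> k v)) \<partial>\<nu>)"
      by (rule Bochner_Integration.integral_cong[OF refl eq])
    also have "\<dots> = e \<bullet> (\<chi> k. \<psi> k u)"
      using int by (simp add: val e_def inner_vec_def mult.assoc)
    also have "\<dots> = e \<bullet> ((N ** L) *v (\<chi> k. \<psi> k u))" by (simp add: N)
    also have "\<dots> = (e v* N) \<bullet> f u"
      by (simp add: f u dot_lmul_matrix matrix_vector_mul_assoc)
    finally have "(\<integral>v. real_of_ereal (K u v) * (b \<bullet> f v) \<partial>\<nu>) = (e v* N) \<bullet> f u" .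
    moreover have "integrable \<nu> (\<lambda>v. real_of_ereal (K u v) * (b \<bullet> f v))"
      using int by (subst Bochner_Integration.integrable_cong[OF refl eq]) simp_all
    ultimately show ?thesis by blast
  qed
  then show ?thesis by blast
qed

section \<open>Integrability of the regression functions and nonsingularity of M(\<nu>)\<close>

text \<open>By continuity the set where \<open>h\<close> is nonzero is relatively open in
  \<open>X\<close>; if it were nonempty, full support would give it positive mass.\<close>

lemma full_support_AE_zero:
  fixes h :: "'a::metric_space \<Rightarrow> real"
  assumes \<nu>: "design X \<nu>" "full_support X \<nu>" and h: "continuous_on X h"
    and ae: "AE x in \<nu>. h x = 0" and x: "x \<in> X"
  shows "h x = 0"
proof (rule ccontr)
  assume "h x \<noteq> 0"
  have s: "sets \<nu> = sets (restrict_space borel X)" using \<nu> by (simp add: design_def)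
  have sp: "space \<nu> = X" using s[THEN sets_eq_imp_space_eq] by (simp add: space_restrict_space)
  obtain U where U: "open U" "U \<inter> X = h -` (- {0}) \<inter> X"
    using h[unfolded continuous_on_open_invariant, rule_format, of "- {0}"] by auto
  then have "measure \<nu> (U \<inter> X) > 0"
    using \<nu>(2) \<open>h x \<noteq> 0\<close> x unfolding full_support_def by blast
  moreover have "measure \<nu> (U \<inter> X) = 0"
  proof -
    have "AE x in \<nu>. x \<notin> U \<inter> X" using ae U(2) by (auto elim!: eventually_mono)
    moreover have "U \<inter> X \<in> sets \<nu>" using U(1) unfolding s sets_restrict_space by auto
    ultimately have "U \<inter> X \<in> null_sets \<nu>" using AE_iff_null_sets by blast
    then show ?thesis by (simp add: null_sets_def measure_def)
  qed
  ultimately show False by simp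
qed

text \<open>Continuous functions on the compact set \<open>X\<close> are bounded, and designs are
  finite measures.\<close>

lemma bounded_components_integrable:
  fixes f :: "'a::metric_space \<Rightarrow> real ^ 'm::finite"
  assumes X: "compact X" and \<xi>: "design X \<xi>" and f: "continuous_on X f"
  shows "integrable \<xi> (\<lambda>u. f u $ i * f u $ j)" and "integrable \<xi> (\<lambda>u. a \<bullet> f u)"
    and "square_integrable \<xi> (\<lambda>u. f u $ i)"
proof -
  have s: "sets \<xi> = sets (restrict_space borel X)" using \<xi> by (simp add: design_def)
  have sp: "space \<xi> = X" using s[THEN sets_eq_imp_space_eq] by (simp add: space_restrict_space)
  interpret prob_space \<xi> using \<xi> by (simp add: design_def)
  have int: "integrable \<xi> h" if h: "continuous_on X h" for h :: "'a \<Rightarrow> real"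
  proof -
    obtain C where C: "\<And>x. x \<in> X \<Longrightarrow> norm (h x) \<le> C"
      using compact_imp_bounded[OF compact_continuous_image[OF h X]] by (auto simp: bounded_iff)
    show ?thesis
    proof (rule integrable_const_bound)
      show "AE x in \<xi>. norm (h x) \<le> C" using C by (intro AE_I2) (simp add: sp)
      show "h \<in> borel_measurable \<xi>"
        using borel_measurable_continuous_on_restrict[OF h] s by (simp cong: measurable_cong_sets)
    qed
  qed
  show "integrable \<xi> (\<lambda>u. f u $ i * f u $ j)" by (intro int continuous_intros f)
  show "integrable \<xi> (\<lambda>u. a \<bullet> f u)" by (intro int continuous_intros f)
  have "integrable \<xi> (\<lambda>u. f u $ i)" "integrable \<xi> (\<lambda>u. (f u $ i)\<^sup>2)"
    by (intro int continuous_intros f)+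
  then show "square_integrable \<xi> (\<lambda>u. f u $ i)" by (simp add: square_integrable_def)
qed

text \<open>A vector \<open>a\<close> in the kernel of the matrix makes the integral of the square
  of \<open>a \<bullet> f\<close> vanish. This function is then zero almost everywhere, hence on all
  of \<open>X\<close> by continuity and full support, and linear independence gives a = 0.\<close>

lemma M_mat_invertible:
  fixes f :: "'a::metric_space \<Rightarrow> real ^ 'm::finite"
  assumes X: "compact X" and \<nu>: "design X \<nu>" "full_support X \<nu>" and f: "continuous_on X f"
    and indep: "\<And>a. (\<forall>x\<in>X. a \<bullet> f x = 0) \<Longrightarrow> a = 0"
  shows "invertible (M_mat f \<nu>)"
  unfolding invertible_left_inverse matrix_left_invertible_ker
proof (intro allI impI)
  fix a assume "M_mat f \<nu> *v a = 0"
  note form = M_mat_form[OF bounded_components_integrable(1)[OF X \<nu>(1) f], of a a]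
  have "(\<integral>u. (a \<bullet> f u) * (a \<bullet> f u) \<partial>\<nu>) = 0"
    using form(2) \<open>M_mat f \<nu> *v a = 0\<close> by simp
  then have ae: "AE u in \<nu>. a \<bullet> f u = 0"
    using integral_nonneg_eq_0_iff_AE[OF form(1)] by simp
  have "continuous_on X (\<lambda>u. a \<bullet> f u)" by (intro continuous_intros f)
  then have "\<forall>x\<in>X. a \<bullet> f x = 0" using full_support_AE_zero[OF \<nu> _ ae] by blast
  then show "a = 0" by (rule indep)
qed

section \<open>Comparison of an arbitrary admissible design with \<nu>\<close>

theorem theorem4p1:
  fixes X :: "'a::metric_space set"
    and \<nu> :: "'a measure"
    and K :: "'a \<Rightarrow> 'a \<Rightarrow> ereal"
    and J :: "nat set"
    and \<phi> :: "nat \<Rightarrow> 'a \<Rightarrow> real"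
    and eig :: "nat \<Rightarrow> real"
    and idx :: "'m::finite \<Rightarrow> nat"
    and L :: "real ^ 'm ^ 'm"
    and f :: "'a \<Rightarrow> real ^ 'm"
    and P :: "'w measure"
    and \<epsilon> y :: "'a \<Rightarrow> 'w \<Rightarrow> real"
    and \<theta> :: "real ^ 'm"
  assumes "compact X"
    and "design X \<nu>"
    and "full_support X \<nu>"
    and "admissible_kernel X K"
    and "defines_integral_operator \<nu> K"
    and "self_adjoint_L2 \<nu> (integral_op \<nu> K)"
    and "compact_operator_L2 \<nu> (integral_op \<nu> K)"
    and "\<And>l. l \<in> J \<Longrightarrow> eig l > 0 \<and> eigenpair X \<nu> K (eig l) (\<phi> l)"
    and "inj idx"
    and "range idx \<subseteq> J"
    and "invertible L"
    and "\<And>x. x \<in> X \<Longrightarrow> f x = L *v (\<chi> k. \<phi> (idx k) x)"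
    and "regression_model P X f K \<theta> \<epsilon> y"
  shows "universally_optimal X K f \<nu>"
proof -
  note X = assms(1) and \<nu> = assms(2)
  have f: "continuous_on X f" and indep: "\<And>a. (\<forall>x\<in>X. a \<bullet> f x = 0) \<Longrightarrow> a = 0"
    using assms(13) by (auto simp: regression_model_def)
  have sym: "K u v = K v u" if "u \<in> X" "v \<in> X" for u v
    using assms(4) that by (simp add: admissible_kernel_def)
  have off: "\<bar>K u v\<bar> \<noteq> \<infinity>" if "u \<in> X" "v \<in> X" "u \<noteq> v" for u v
    using assms(4) that by (simp add: admissible_kernel_def del: abs_ereal.simps)
  have pd: "positive_definite_kernel X K" using assms(4) by (simp add: admissible_kernel_def)
  have design_measure: "finite_borel_measure_on X \<xi>" "space \<xi> = X" if "design X \<xi>" for \<xi>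
  proof -
    have s: "sets \<xi> = sets (restrict_space borel X)" using that by (simp add: design_def)
    show "space \<xi> = X" using s[THEN sets_eq_imp_space_eq] by (simp add: space_restrict_space)
    show "finite_borel_measure_on X \<xi>"
      using that s by (simp add: design_def finite_borel_measure_on_def prob_space_def)
  qed
  have op: "ereal_integrable (\<nu> \<Otimes>\<^sub>M \<nu>) (\<lambda>(u, v). K u v * ereal (g u) * ereal (h v))"
    if "square_integrable \<nu> g" "square_integrable \<nu> h" for g h
    using assms(5) that by (simp add: defines_integral_operator_def)
  interpret N: prob_space \<nu> using \<nu> by (simp add: design_def)
  \<comment> \<open>Testing the operator on constant functions shows that \<open>K\<close> itself is
    integrable for the product of \<nu> with itself, which yields both its measurability and its
    finiteness almost everywhere.\<close>
  have "square_integrable \<nu> (\<lambda>_. 1)" by (simp add: square_integrable_def)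
  from op[OF this this] have K1: "ereal_integrable (\<nu> \<Otimes>\<^sub>M \<nu>) (\<lambda>(u, v). K u v)"
    by (simp add: one_ereal_def[symmetric])
  then have k: "(\<lambda>(u, v). real_of_ereal (K u v)) \<in> borel_measurable (\<nu> \<Otimes>\<^sub>M \<nu>)"
    and Kfin: "AE (u, v) in \<nu> \<Otimes>\<^sub>M \<nu>. \<bar>K u v\<bar> \<noteq> \<infinity>"
    by (auto simp: ereal_integrable_def split_beta' dest: borel_measurable_integrable)
  \<comment> \<open>The components of \<open>f\<close> are square integrable, so B(\<nu>,\<nu>) is
    well defined by the convergence clause of the integral operator.\<close>
  have adm: "\<nu> \<in> admissible_designs X K f"
    using \<nu> bounded_components_integrable[OF X \<nu> f] M_mat_invertible[OF X \<nu> assms(3) f indep] op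
    by (simp add: admissible_designs_def)
  have eigk: "eigenpair X \<nu> K (eig (idx k)) (\<phi> (idx k))" for k
    using assms(8)[of "idx k"] assms(10) by blast
  have le: "z \<bullet> (D_mat K f \<nu> *v z) \<le> z \<bullet> (D_mat K f \<xi> *v z)"
    if \<xi>: "\<xi> \<in> admissible_designs X K f" for \<xi> z
  proof -
    have \<xi>X: "design X \<xi>" using \<xi> by (simp add: admissible_designs_def)
    \<comment> \<open>Coefficient vectors of the signed measures attached to \<xi> and \<nu>; the
      energies of these measures are the two variances to be compared.\<close>
    define a b where "a = matrix_inv (M_mat f \<xi>) *v z" and "b = matrix_inv (M_mat f \<nu>) *v z"
    let ?g = "\<lambda>u. a \<bullet> f u" and ?h = "\<lambda>u. b \<bullet> f u"
    obtain d where d: "\<And>u. u \<in> X \<Longrightarrow> integrable \<nu> (\<lambda>v. real_of_ereal (K u v) * ?h v)"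
      "\<And>u. u \<in> X \<Longrightarrow> (\<integral>v. real_of_ereal (K u v) * ?h v \<partial>\<nu>) = d \<bullet> f u"
      using integral_operator_eigenfunction_span[OF design_measure(2)[OF \<nu>] eigk assms(11,12), of b]
      by blast
    \<comment> \<open>The factor M(\<rho>) produced by the integral cancels the inverse in the
      coefficient vector, so the value is the same for every admissible design \<rho>.\<close>
    have moment: "integrable \<rho> (\<lambda>u. ((matrix_inv (M_mat f \<rho>) *v z) \<bullet> f u) * (d \<bullet> f u))"
      "(\<integral>u. ((matrix_inv (M_mat f \<rho>) *v z) \<bullet> f u) * (d \<bullet> f u) \<partial>\<rho>) = d \<bullet> z"
      if "\<rho> \<in> admissible_designs X K f" for \<rho>
    proof -
      have i: "integrable \<rho> (\<lambda>u. f u $ i * f u $ j)" for i j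
        using that by (simp add: admissible_designs_def)
      have inv: "invertible (M_mat f \<rho>)" using that by (simp add: admissible_designs_def)
      note form = M_mat_form[OF i, of d "matrix_inv (M_mat f \<rho>) *v z"]
      show "integrable \<rho> (\<lambda>u. ((matrix_inv (M_mat f \<rho>) *v z) \<bullet> f u) * (d \<bullet> f u))"
        using form(1) by (simp add: mult.commute)
      have "d \<bullet> (M_mat f \<rho> *v (matrix_inv (M_mat f \<rho>) *v z)) = d \<bullet> z"
        by (simp add: matrix_vector_mul_assoc matrix_inv_works(1)[OF inv])
      then show "(\<integral>u. ((matrix_inv (M_mat f \<rho>) *v z) \<bullet> f u) * (d \<bullet> f u) \<partial>\<rho>) = d \<bullet> z"
        using form(2) by (simp add: mult.commute)
    qed
    have variance: "kernel_form_defined K \<rho> (\<lambda>u. (matrix_inv (M_mat f \<rho>) *v z) \<bullet> f u) \<rho>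
          (\<lambda>u. (matrix_inv (M_mat f \<rho>) *v z) \<bullet> f u)"
      "kernel_form K \<rho> (\<lambda>u. (matrix_inv (M_mat f \<rho>) *v z) \<bullet> f u) \<rho>
          (\<lambda>u. (matrix_inv (M_mat f \<rho>) *v z) \<bullet> f u) = z \<bullet> (D_mat K f \<rho> *v z)"
      if "\<rho> \<in> admissible_designs X K f" for \<rho>
    proof -
      have B: "ereal_integrable (\<rho> \<Otimes>\<^sub>M \<rho>) (\<lambda>(u, v). K u v * ereal (f u $ i) * ereal (f v $ j))" for i j
        using that by (simp add: admissible_designs_def)
      have inv: "invertible (M_mat f \<rho>)" using that by (simp add: admissible_designs_def)
      note form = B_mat_form[of \<rho> K f, OF B]
      show "kernel_form_defined K \<rho> (\<lambda>u. (matrix_inv (M_mat f \<rho>) *v z) \<bullet> f u) \<rho>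
          (\<lambda>u. (matrix_inv (M_mat f \<rho>) *v z) \<bullet> f u)" by (rule form(1))
      show "kernel_form K \<rho> (\<lambda>u. (matrix_inv (M_mat f \<rho>) *v z) \<bullet> f u) \<rho>
          (\<lambda>u. (matrix_inv (M_mat f \<rho>) *v z) \<bullet> f u) = z \<bullet> (D_mat K f \<rho> *v z)"
        by (simp only: form(2) D_mat_form[OF inv])
    qed
    \<comment> \<open>By Fubini the energy is the integral of the potential
      \<open>d \<bullet> f\<close> against the signed measure itself.\<close>
    have "kernel_form K \<nu> ?h \<nu> ?h = (\<integral>u. \<integral>v. real_of_ereal (K u v) * ?h u * ?h v \<partial>\<nu> \<partial>\<nu>)"
    proof -
      interpret NN: pair_sigma_finite \<nu> \<nu> ..
      show ?thesis using variance(1)[OF adm]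
        unfolding kernel_form_def kernel_form_defined_def b_def
        by (simp add: NN.integral_fst'[symmetric])
    qed
    also have "\<dots> = (\<integral>u. ?h u * (d \<bullet> f u) \<partial>\<nu>)"
    proof (rule Bochner_Integration.integral_cong[OF refl])
      fix u assume "u \<in> space \<nu>"
      then have "?h u * (d \<bullet> f u) = (\<integral>v. ?h u * (real_of_ereal (K u v) * ?h v) \<partial>\<nu>)"
        by (simp add: d(2) design_measure(2)[OF \<nu>])
      then show "(\<integral>v. real_of_ereal (K u v) * ?h u * ?h v \<partial>\<nu>) = ?h u * (d \<bullet> f u)"
        by (simp add: mult_ac)
    qed
    also have "\<dots> = d \<bullet> z" unfolding b_def by (rule moment(2)[OF adm])
    finally have hh: "kernel_form K \<nu> ?h \<nu> ?h = d \<bullet> z" .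
    \<comment> \<open>The integral on the left and the last energy both equal
      \<open>d \<bullet> z\<close>, so cancelling one copy leaves the desired inequality.\<close>
    have "2 * (\<integral>u. ?g u * (d \<bullet> f u) \<partial>\<xi>) \<le> kernel_form K \<xi> ?g \<xi> ?g + kernel_form K \<nu> ?h \<nu> ?h"
    proof (rule kernel_form_eigen_bound[OF pd sym design_measure(1)[OF \<xi>X] design_measure(1)[OF \<nu>] k])
      show "AE (u, v) in \<xi> \<Otimes>\<^sub>M \<nu>. \<bar>K u v\<bar> \<noteq> \<infinity>"
        by (rule AE_finite_off_diagonal_kernel[OF X design_measure(1)[OF \<xi>X] design_measure(1)[OF \<nu>] off Kfin])
      show "integrable \<xi> ?g" "integrable \<nu> ?h"
        using bounded_components_integrable(2)[OF X _ f] \<xi>X \<nu> by auto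
      show "kernel_form_defined K \<xi> ?g \<xi> ?g" "kernel_form_defined K \<nu> ?h \<nu> ?h"
        unfolding a_def b_def using variance(1) \<xi> adm by auto
      show "integrable \<xi> (\<lambda>u. ?g u * (d \<bullet> f u))"
        unfolding a_def by (rule moment(1)[OF \<xi>])
    qed (use d in auto)
    moreover have "(\<integral>u. ?g u * (d \<bullet> f u) \<partial>\<xi>) = d \<bullet> z" unfolding a_def by (rule moment(2)[OF \<xi>])
    moreover have "kernel_form K \<xi> ?g \<xi> ?g = z \<bullet> (D_mat K f \<xi> *v z)"
      unfolding a_def by (rule variance(2)[OF \<xi>])
    moreover have "kernel_form K \<nu> ?h \<nu> ?h = z \<bullet> (D_mat K f \<nu> *v z)"
      unfolding b_def by (rule variance(2)[OF adm])
    ultimately show ?thesis using hh by simp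
  qed
  \<comment> \<open>The Loewner ordering also demands that the difference of the two matrices be
    symmetric.\<close>
  have D_sym: "transpose (D_mat K f \<xi>) = D_mat K f \<xi>" if "\<xi> \<in> admissible_designs X K f" for \<xi>
  proof (rule D_mat_symmetric)
    have \<xi>: "design X \<xi>" using that by (simp add: admissible_designs_def)
    show "invertible (M_mat f \<xi>)" using that by (simp add: admissible_designs_def)
    show "transpose (B_mat K f \<xi>) = B_mat K f \<xi>"
    proof (rule B_mat_symmetric)
      show "finite_measure \<xi>" using \<xi> by (simp add: design_def prob_space_def)
      show "K u v = K v u" if "u \<in> space \<xi>" "v \<in> space \<xi>" for u v
        using that sym by (simp add: design_measure(2)[OF \<xi>])
    qed (use that in \<open>simp add: admissible_designs_def\<close>)
  qed
  show ?thesis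
    unfolding universally_optimal_def loewner_le_def
    using adm le D_sym
    by (simp add: transpose_diff matrix_vector_mult_diff_rdistrib inner_diff_right)
qed

end
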